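(* Let $\mathcal{A}$ be a bridge-alterable class of graphs, let $n$ be a positive integer such that $\mathcal{A}_n$ is non-empty, let $R_n$ be a uniformly random element of $\mathcal{A}_n$, and for each $t = 1, 2, \ldots$ let $F_t$ be a uniformly random element of $\mathcal{F}_t$. Let $\alpha = 0.48$. Then $$\mathbb{P}(R_n \text{ is connected}) \;\geq\; \min_{\alpha n \leq t \leq n} \mathbb{P}(F_t \text{ is connected}),$$ where the minimum is over integers $t$ with $\alpha n \le t \le n$.
   Context: Graphs are finite, simple and labelled. A bridge of a graph is an edge whose deletion increases the number of connected components. A class (collection) $\mathcal{A}$ of graphs is called bridge-alterable if, for each graph $G$ and each bridge $e$ of $G$, $G \in \mathcal{A}$ if and only if $G - e \in \mathcal{A}$ (where $G-e$ is $G$ with the edge $e$ deleted, same vertex set). Equivalently, $\mathcal{A}$ is closed under adding an edge between two vertices in different components and closed under deleting bridges. For a class $\mathcal{A}$ and a positive integer $n$, $\mathcal{A}_n$ denotes the set of graphs in $\mathcal{A}$ with vertex set $[n] = \{1,\ldots,n\}$. $\mathcal{F}$ denotes the class of all forests (acyclic graphs), so $\mathcal{F}_t$ is the set of all forests on vertex set $\{1,\ldots,t\}$. *)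

theory Defs
  imports "HOL-Probability.Probability_Mass_Function"
begin

record 'v graph =
  verts :: "'v set"
  edges :: "'v set set"

definition simple_graph :: "'v graph \<Rightarrow> bool" where
  "simple_graph G \<longleftrightarrow>
     finite (verts G) \<and> (\<forall>e\<in>edges G. e \<subseteq> verts G \<and> card e = 2)"

definition adj :: "'v graph \<Rightarrow> 'v rel" where
  "adj G = {(u, v). {u, v} \<in> edges G}"

definition reach :: "'v graph \<Rightarrow> 'v rel" where
  "reach G = (adj G)\<^sup>* \<inter> (verts G \<times> verts G)"

definition graph_components :: "'v graph \<Rightarrow> 'v set set" where
  "graph_components G = verts G // reach G"

definition connected_graph :: "'v graph \<Rightarrow> bool" where
  "connected_graph G \<longleftrightarrow>
     verts G \<noteq> {} \<and> (\<forall>u\<in>verts G. \<forall>v\<in>verts G. (u, v) \<in> reach G)"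

definition delete_edge :: "'v graph \<Rightarrow> 'v set \<Rightarrow> 'v graph" where
  "delete_edge G e = G\<lparr>edges := edges G - {e}\<rparr>"

definition bridge :: "'v graph \<Rightarrow> 'v set \<Rightarrow> bool" where
  "bridge G e \<longleftrightarrow>
     e \<in> edges G \<and> card (graph_components G) < card (graph_components (delete_edge G e))"

definition is_cycle :: "'v graph \<Rightarrow> 'v list \<Rightarrow> bool" where
  "is_cycle G c \<longleftrightarrow> length c \<ge> 3 \<and> distinct c \<and>
     (\<forall>i<length c. {c ! i, c ! (Suc i mod length c)} \<in> edges G)"

text \<open>
  Labels are natural numbers. A class is an arbitrary set of labelled simple graphs; it is not
  required to be closed under isomorphism.
\<close>

definition graph_class :: "nat graph set \<Rightarrow> bool" where
  "graph_class A \<longleftrightarrow> (\<forall>G\<in>A. simple_graph G)"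

definition bridge_alterable :: "nat graph set \<Rightarrow> bool" where
  "bridge_alterable A \<longleftrightarrow>
     (\<forall>G e. simple_graph G \<longrightarrow> bridge G e \<longrightarrow> (G \<in> A \<longleftrightarrow> delete_edge G e \<in> A))"

definition graphs_on :: "nat graph set \<Rightarrow> nat \<Rightarrow> nat graph set" where
  "graphs_on A n = {G \<in> A. verts G = {1..n}}"

definition forests :: "nat graph set" where
  "forests = {G. simple_graph G \<and> \<not> (\<exists>c. is_cycle G c)}"

text \<open>
  The following two facts make \<open>pmf_of_set\<close> the uniform distribution on the sets of graphs
  it is applied to; it is unspecified on empty or infinite sets.
\<close>

lemma finite_graphs_on:
  assumes "graph_class A"
  shows "finite (graphs_on A n)"
proof (rule finite_subset)
  show "graphs_on A n \<subseteq> (\<lambda>E. \<lparr>verts = {1..n}, edges = E\<rparr>) ` Pow (Pow {1..n})"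
  proof
    fix G assume G: "G \<in> graphs_on A n"
    then have "edges G \<subseteq> Pow {1..n}"
      using assms unfolding graphs_on_def graph_class_def simple_graph_def by blast
    moreover have "G = \<lparr>verts = {1..n}, edges = edges G\<rparr>"
      using G by (simp add: graphs_on_def)
    ultimately show "G \<in> (\<lambda>E. \<lparr>verts = {1..n}, edges = E\<rparr>) ` Pow (Pow {1..n})"
      by blast
  qed
qed simp

lemma forests_on_finite_nonempty:
  "finite (graphs_on forests n)" "graphs_on forests n \<noteq> {}"
proof -
  show "finite (graphs_on forests n)"
    by (rule finite_graphs_on) (simp add: graph_class_def forests_def)
  have "\<lparr>verts = {1..n}, edges = {}\<rparr> \<in> graphs_on forests n"
    by (auto simp: graphs_on_def forests_def simple_graph_def is_cycle_def intro!: exI[of _ 0])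
  then show "graphs_on forests n \<noteq> {}"
    by blast
qed

definition prob_connected :: "nat graph set \<Rightarrow> nat \<Rightarrow> real" where
  "prob_connected A n = measure_pmf.prob (pmf_of_set (graphs_on A n)) {G. connected_graph G}"

end

theory Submission
  imports Defs
begin

text \<open>
  In fact \<open>t = n\<close> already works: a random graph of \<open>A\<close> on \<open>{1..n}\<close> is at least as likely to be
  connected as a random forest on \<open>{1..n}\<close>.

  Deleting all bridges of a graph splits the graphs of \<open>A\<close> on \<open>{1..n}\<close> into fibres; the fibre of a
  bridgeless graph consists of all ways of adding a forest on top of its partition into components.
  So one compares, for partitions of the vertex set, the proportion of connected graphs among
  these forests, and it suffices to treat one step that moves a vertex \<open>v\<close> out of the block of \<open>u\<close>
  into a block of its own. Let \<open>a\<close> be the size of the remaining block \<open>U\<close> of \<open>u\<close>. The forests over the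
  coarser partition are the forests \<open>X\<close> over the finer one in which \<open>u\<close> and \<open>v\<close> are separated.
  Write \<open>W\<^sub>u\<close> and \<open>W\<^sub>v\<close> for the sizes of the components of \<open>u\<close> and \<open>v\<close>. Then:

  \<^item> adding an edge from \<open>v\<close> to the component of \<open>u\<close> shows that \<open>\<Sum>\<^sub>X W\<^sub>u\<close> counts the forests that
    link \<open>u\<close> and \<open>v\<close>;
  \<^item> redirecting the last edge of the path from a vertex \<open>y\<close> to \<open>U\<close> so that it ends at \<open>v\<close> gives
    \<open>\<Sum>\<^sub>X W\<^sub>u = a \<Sum>\<^sub>X W\<^sub>v\<close>, both for all forests and for those with \<open>W\<^sub>u + W\<^sub>v = n\<close>;
  \<^item> redirecting edges in the same way towards a third vertex \<open>z\<close>, followed by adding an edge between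
    \<open>z\<close> and \<open>U\<close>, gives \<open>a \<Sum>\<^sub>X (n - W\<^sub>u - W\<^sub>v) \<le> (a + 1) |X|\<close>.

  Hence \<open>a n |X|\<close> is at most \<open>a + 1\<close> times the number of forests over the finer partition, with
  equality when only connected graphs are counted on both sides.
\<close>

section \<open>Forests over a partition\<close>

text \<open>Linking contracts the classes of \<open>r\<close> but keeps the edges of
  \<open>D\<close> on actual vertices, so different edges between the same two blocks count as
  different. With \<open>r = {}\<close> it is ordinary connectivity by \<open>D\<close>.\<close>

definition linked :: "'a rel \<Rightarrow> 'a set set \<Rightarrow> 'a rel" where
  "linked r D = (r \<union> {(x, y). {x, y} \<in> D})\<^sup>*"

text \<open>Acyclicity is encoded as every edge being needed to link its own ends. As linking is
  reflexive and contains \<open>r\<close>, this also excludes loops and edges inside a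
  block.\<close>

definition forest_sets :: "'a set \<Rightarrow> 'a rel \<Rightarrow> 'a set set set" where
  "forest_sets V r = {D. D \<subseteq> {{x, y} | x y. x \<in> V \<and> y \<in> V} \<and>
     (\<forall>x y. {x, y} \<in> D \<longrightarrow> (x, y) \<notin> linked r (D - {{x, y}}))}"

lemma linked_refl: "(x, x) \<in> linked r D"
  by (simp add: linked_def)

lemma linked_trans: "(x, y) \<in> linked r D \<Longrightarrow> (y, z) \<in> linked r D \<Longrightarrow> (x, z) \<in> linked r D"
  unfolding linked_def by (rule rtrancl_trans)

lemma linked_sym:
  assumes "sym r" "(x, y) \<in> linked r D"
  shows "(y, x) \<in> linked r D"
proof -
  have "sym (r \<union> {(x, y). {x, y} \<in> D})"
    using assms(1) by (auto simp: sym_def insert_commute)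
  then show ?thesis
    using assms(2) unfolding linked_def by (meson sym_rtrancl symD)
qed

lemma linked_mono: "D \<subseteq> E \<Longrightarrow> (x, y) \<in> linked r D \<Longrightarrow> (x, y) \<in> linked r E"
  unfolding linked_def by (rule subsetD[OF rtrancl_mono]) auto

lemma linked_edge: "{x, y} \<in> D \<Longrightarrow> (x, y) \<in> linked r D"
  unfolding linked_def by auto

lemma linked_base: "(x, y) \<in> r \<Longrightarrow> (x, y) \<in> linked r D"
  unfolding linked_def by auto

text \<open>A walk can be shortened to cross \<open>{a, b}\<close> at most once, in one of two
  directions. This reduces adding or removing an edge to propositional reasoning about the remaining
  edges.\<close>

lemma linked_insert:
  assumes "sym r"
  shows "(x, y) \<in> linked r (insert {a, b} D) \<longleftrightarrow> (x, y) \<in> linked r D \<or>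
    (x, a) \<in> linked r D \<and> (b, y) \<in> linked r D \<or> (x, b) \<in> linked r D \<and> (a, y) \<in> linked r D"
    (is "?L \<longleftrightarrow> ?R x y")
proof
  assume ?L
  then have "(x, y) \<in> (r \<union> {(x, y). {x, y} \<in> insert {a, b} D})\<^sup>*"
    by (simp add: linked_def)
  then show "?R x y"
  proof (induction rule: rtrancl_induct)
    case base
    then show ?case by (simp add: linked_refl)
  next
    case (step y z)
    have "(y, z) \<in> linked r D \<or> y = a \<and> z = b \<or> y = b \<and> z = a"
      using step.hyps(2) linked_edge[of y z D r] linked_base[of y z r D]
      by (auto simp: doubleton_eq_iff)
    then show ?case
      using step.IH by (metis linked_refl linked_trans)
  qed
next
  have ab: "(a, b) \<in> linked r (insert {a, b} D)" "(b, a) \<in> linked r (insert {a, b} D)"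
    by (auto intro!: linked_edge simp: insert_commute)
  assume "?R x y"
  then show ?L
    using ab linked_mono[of D "insert {a, b} D" _ _ r] by (meson linked_trans subset_insertI)
qed

section \<open>Forests over a fixed partition and the edges entering a block\<close>

locale vertex_partition =
  fixes V :: "'a set" and r :: "'a rel"
  assumes finite_verts: "finite V" and equiv: "equiv V r"
begin

abbreviation con :: "'a set set \<Rightarrow> 'a \<Rightarrow> 'a \<Rightarrow> bool" where
  "con D x y \<equiv> (x, y) \<in> linked r D"

lemma sym_r: "sym r"
  using equiv by (rule equivE)

lemma r_in: "(x, y) \<in> r \<Longrightarrow> x \<in> V" "(x, y) \<in> r \<Longrightarrow> y \<in> V"
  using equiv by (auto simp: equiv_def)

lemma r_refl: "x \<in> V \<Longrightarrow> (x, x) \<in> r"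
  using equiv by (auto simp: equiv_def refl_on_def)

lemma r_trans: "(x, y) \<in> r \<Longrightarrow> (y, z) \<in> r \<Longrightarrow> (x, z) \<in> r"
  using equiv by (auto simp: equiv_def dest: transD)

lemma r_sym: "(x, y) \<in> r \<Longrightarrow> (y, x) \<in> r"
  using sym_r by (rule symD)

lemmas con_sym = linked_sym[OF sym_r]
lemmas con_insert = linked_insert[OF sym_r]

lemma finite_forest_sets: "finite (forest_sets V r)"
proof (rule finite_subset)
  show "forest_sets V r \<subseteq> Pow (Pow V)"
    by (auto simp: forest_sets_def)
qed (simp add: finite_verts)

lemma forest_edge:
  assumes "D \<in> forest_sets V r" "{x, y} \<in> D"
  shows "\<not> con (D - {{x, y}}) x y" "x \<in> V" "y \<in> V"
proof -
  show "\<not> con (D - {{x, y}}) x y"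
    using assms by (auto simp: forest_sets_def)
  have "{x, y} \<in> {{x, y} | x y. x \<in> V \<and> y \<in> V}"
    using assms by (auto simp: forest_sets_def)
  then show "x \<in> V" "y \<in> V"
    by (auto simp: doubleton_eq_iff)
qed

lemma forest_subset:
  assumes "D \<in> forest_sets V r" "E \<subseteq> D"
  shows "E \<in> forest_sets V r"
  using assms linked_mono[of "E - {{x, y}}" "D - {{x, y}}" x y r for x y]
  unfolding forest_sets_def by blast

lemma forest_insert:
  assumes D: "D \<in> forest_sets V r" and ab: "a \<in> V" "b \<in> V" "\<not> con D a b"
  shows "insert {a, b} D \<in> forest_sets V r"
proof -
  have "\<not> con (insert {a, b} D - {{x, y}}) x y" if xy: "{x, y} \<in> insert {a, b} D" for x y
  proof (cases "{x, y} = {a, b}")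
    case True
    then have "{a, b} \<notin> D" using ab(3) linked_edge by metis
    then have eq: "insert {a, b} D - {{x, y}} = D" using True by simp
    have "\<not> con D b a" using ab(3) con_sym by blast
    then have "\<not> con D x y"
      using True ab(3) unfolding doubleton_eq_iff by blast
    then show ?thesis unfolding eq .
  next
    case False
    then have xyD: "{x, y} \<in> D" using xy by simp
    have eq: "insert {a, b} D - {{x, y}} = insert {a, b} (D - {{x, y}})"
      using False by auto
    have mono: "con D s t" if "con (D - {{x, y}}) s t" for s t
      using that linked_mono[of "D - {{x, y}}" D] by blast
    show ?thesis
      unfolding eq con_insert
      using forest_edge(1)[OF D xyD] ab(3) mono linked_edge[OF xyD, of r] linked_trans con_sym
      by metis
  qed
  then show ?thesis
    using D ab unfolding forest_sets_def by blast
qed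

text \<open>In a forest, \<open>enters D y u p q\<close> says that \<open>{p, q}\<close> is the edge by which the path
  from \<open>y\<close> first reaches the block of \<open>u\<close>, with \<open>q\<close> the endpoint in that block.\<close>

definition enters :: "'a set set \<Rightarrow> 'a \<Rightarrow> 'a \<Rightarrow> 'a \<Rightarrow> 'a \<Rightarrow> bool" where
  "enters D y u p q \<longleftrightarrow> {p, q} \<in> D \<and> (q, u) \<in> r \<and> con (D - {{p, q}}) y p"

lemma enters_exists:
  assumes "con D y u" "(y, u) \<notin> r" "u \<in> V"
  shows "\<exists>p q. enters D y u p q"
proof -
  have "(y, u) \<in> (r \<union> {(x, y). {x, y} \<in> D})\<^sup>*"
    using assms(1) by (simp add: linked_def)
  then show ?thesis
    using assms(2)
  proof (induction rule: converse_rtrancl_induct)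
    case base
    then show ?case using r_refl assms(3) by blast
  next
    case (step y z)
    show ?case
    proof (cases "(z, u) \<in> r")
      case True
      then have "{y, z} \<in> D" using step r_trans by blast
      then have "enters D y u y z" using True by (simp add: enters_def linked_refl)
      then show ?thesis by blast
    next
      case False
      then obtain p q where pq: "{p, q} \<in> D" "(q, u) \<in> r" "con (D - {{p, q}}) z p"
        using step.IH unfolding enters_def by blast
      have "con (D - {{p, q}}) y p"
      \<comment> \<open>The first step of the path survives the deletion of \<open>{p, q}\<close>
        unless it is that edge. Then \<open>y = q\<close> is impossible because \<open>y\<close>
        lies outside the block of \<open>u\<close>, so \<open>y = p\<close>.\<close>
      proof (cases "{y, z} = {p, q} \<and> (y, z) \<notin> r")
        case True
        then have "y = p" using step.prems pq(2) by (auto simp: doubleton_eq_iff)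
        then show ?thesis by (simp add: linked_refl)
      next
        case False
        then have "con (D - {{p, q}}) y z"
          using step.hyps(1) by (auto intro: linked_edge linked_base)
        then show ?thesis using pq(3) linked_trans by metis
      qed
      then show ?thesis using pq unfolding enters_def by blast
    qed
  qed
qed

text \<open>Two different entering edges would close a cycle, since their ends \<open>q\<close> and
  \<open>q'\<close> lie in the same contracted block.\<close>

lemma enters_unique:
  assumes D: "D \<in> forest_sets V r" and e1: "enters D y u p q" and e2: "enters D y u p' q'"
  shows "p = p' \<and> q = q'"
proof -
  have qq: "(q, q') \<in> r" "(q', q) \<in> r"
    using e1 e2 r_trans r_sym unfolding enters_def by blast+
  have n1: "\<not> con (D - {{p, q}}) p q" and n2: "\<not> con (D - {{p', q'}}) p' q'"
    using e1 e2 forest_edge(1)[OF D] unfolding enters_def by blast+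
  have eq: "{p, q} = {p', q'}"
  proof (rule ccontr)
    assume ne: "{p, q} \<noteq> {p', q'}"
    \<comment> \<open>With both edges removed, every linking statement involved expands over the
      same set \<open>R\<close>.\<close>
    define R where "R = D - {{p, q}, {p', q'}}"
    have D1: "D - {{p, q}} = insert {p', q'} R" and D2: "D - {{p', q'}} = insert {p, q} R"
      using ne e1 e2 unfolding R_def enters_def by auto
    have c1: "con R y p \<or> con R y p' \<and> con R q' p \<or> con R y q' \<and> con R p' p"
      using e1 unfolding enters_def D1 con_insert by blast
    have c2: "con R y p' \<or> con R y p \<and> con R q p' \<or> con R y q \<and> con R p p'"
      using e2 unfolding enters_def D2 con_insert by blast
    have base: "con R q q'" "con R q' q" using qq by (auto intro: linked_base)
    have n1': "\<not> con R p q \<and> \<not> (con R p p' \<and> con R q' q) \<and> \<not> (con R p q' \<and> con R p' q)"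
      using n1 unfolding D1 con_insert by blast
    have n2': "\<not> con R p' q' \<and> \<not> (con R p' p \<and> con R q q') \<and> \<not> (con R p' q \<and> con R p q')"
      using n2 unfolding D2 con_insert by blast
    show False
      using c1 c2 n1' n2' base con_sym[of _ _ R] linked_trans[of _ _ r R] by meson
  qed
  \<comment> \<open>The same edge traversed in the opposite direction would have both ends in the
    block of \<open>u\<close>.\<close>
  have "\<not> (p = q' \<and> q = p')"
    using n1 qq by (metis linked_base r_sym)
  then show ?thesis using eq by (auto simp: doubleton_eq_iff)
qed

text \<open>Deleting \<open>{p, q}\<close> detaches the part containing \<open>y\<close> from
  \<open>u\<close>; attaching it at \<open>q'\<close> moves it to the component of \<open>v\<close>.
  The third and fourth conclusions make the move reversible, and by the fifth the union of the two
  components stays the same.\<close>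

lemma enters_switch:
  assumes D: "D \<in> forest_sets V r" and e: "enters D y u p q" and uv: "\<not> con D u v"
    and q': "(q', v) \<in> r" and D': "D' = insert {p, q'} (D - {{p, q}})"
  shows "D' \<in> forest_sets V r" "\<not> con D' u v" "enters D' y v p q'"
    "D = insert {p, q} (D' - {{p, q'}})"
    "con D' u x \<or> con D' v x \<longleftrightarrow> con D u x \<or> con D v x"
proof -
  define R where "R = D - {{p, q}}"
  have pq: "{p, q} \<in> D" "(q, u) \<in> r" "con R y p"
    using e unfolding enters_def R_def by auto
  have DR: "D = insert {p, q} R" and D'R: "D' = insert {p, q'} R"
    using pq D' unfolding R_def by auto
  have base: "con R q u" "con R u q" "con R q' v" "con R v q'"
    using pq q' r_sym by (auto intro: linked_base)
  have npq: "\<not> con R p q" using forest_edge(1)[OF D pq(1)] unfolding R_def .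
  \<comment> \<open>A link from \<open>p\<close> to \<open>v\<close> in \<open>R\<close> would
    extend over \<open>{p, q}\<close> to a link between \<open>u\<close> and \<open>v\<close> in
    \<open>D\<close>.\<close>
  have uvR: "\<not> con R u v" "\<not> con R p v"
    using uv base unfolding DR con_insert by (auto intro: linked_refl)
  have npq': "\<not> con R p q'" using uvR base linked_trans by metis
  then have notin: "{p, q'} \<notin> R" using linked_edge by metis
  show "D' \<in> forest_sets V r"
    unfolding D'R
  proof (rule forest_insert)
    show "R \<in> forest_sets V r" unfolding R_def by (rule forest_subset[OF D]) auto
    show "p \<in> V" by (rule forest_edge[OF D pq(1)])
    show "q' \<in> V" using q' by (rule r_in)
  qed (fact npq')
  show "\<not> con D' u v"
    unfolding D'R con_insert using uvR base npq con_sym[of _ _ R] linked_trans[of _ _ r R] by meson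
  show "enters D' y v p q'"
    unfolding enters_def D'R using notin pq(3) q' by simp
  show "D = insert {p, q} (D' - {{p, q'}})"
    unfolding D'R using notin DR by simp
  show "con D' u x \<or> con D' v x \<longleftrightarrow> con D u x \<or> con D v x"
    unfolding D'R DR con_insert using base con_sym[of _ _ R] linked_trans[of _ _ r R] linked_refl
    by meson
qed

subsection \<open>Double counting\<close>

text \<open>The argument \<open>q\<close> keeps the old endpoint in the block of \<open>u\<close>,
  which is the information that \<open>D'\<close> alone has lost.\<close>

definition switch :: "'a set set \<Rightarrow> 'a \<Rightarrow> 'a \<Rightarrow> 'a \<Rightarrow> 'a set set \<Rightarrow> 'a \<Rightarrow> bool" where
  "switch D y u q' D' q \<longleftrightarrow> (\<exists>p. enters D y u p q \<and> D' = insert {p, q'} (D - {{p, q}}))"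

lemma switch_exists:
  assumes D: "D \<in> forest_sets V r" "\<not> con D u v" and y: "con D u y" "(u, y) \<notin> r"
    and uv: "u \<in> V" "(v, q') \<in> r"
  obtains D' q where "switch D y u q' D' q" "(u, q) \<in> r" "D' \<in> forest_sets V r"
    "\<not> con D' u v" "con D' v y" "(v, y) \<notin> r"
proof -
  have "con D y u" "(y, u) \<notin> r" using y con_sym r_sym by blast+
  then obtain p q where e: "enters D y u p q"
    using enters_exists uv(1) by blast
  define D' where "D' = insert {p, q'} (D - {{p, q}})"
  have q': "(q', v) \<in> r" using uv(2) by (rule r_sym)
  note sw = enters_switch[OF D(1) e D(2) q' D'_def]
  have "con (D' - {{p, q'}}) y p" "{p, q'} \<in> D'"
    using sw(3) unfolding enters_def by auto
  then have "con D' y p" "con D' p q'"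
    using linked_mono[of "D' - {{p, q'}}" D' y p r] linked_edge[of p q' D' r] by auto
  then have vy: "con D' v y"
    using linked_base[OF q'] linked_trans con_sym by metis
  have "(v, y) \<notin> r"
    using D(2) y(1) linked_base[of v y r D] con_sym linked_trans by metis
  moreover have "(u, q) \<in> r" using e r_sym unfolding enters_def by blast
  moreover have "switch D y u q' D' q" using e D'_def unfolding switch_def by blast
  ultimately show thesis
    using that sw(1,2) vy by blast
qed

text \<open>In \<open>D'\<close> the new edge is the one by which the path from \<open>y\<close>
  enters the block of \<open>v\<close>, so uniqueness of entering edges recovers \<open>p\<close>
  and the new endpoint; with \<open>q\<close> known the switch can be undone.\<close>

lemma switch_inj:
  assumes "D1 \<in> forest_sets V r" "\<not> con D1 u v" "(v, q1) \<in> r" "switch D1 y u q1 D' q"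
    and "D2 \<in> forest_sets V r" "\<not> con D2 u v" "(v, q2) \<in> r" "switch D2 y u q2 D' q"
  shows "D1 = D2 \<and> q1 = q2"
proof -
  obtain p1 where p1: "enters D1 y u p1 q" "D' = insert {p1, q1} (D1 - {{p1, q}})"
    using assms(4) unfolding switch_def by blast
  obtain p2 where p2: "enters D2 y u p2 q" "D' = insert {p2, q2} (D2 - {{p2, q}})"
    using assms(8) unfolding switch_def by blast
  note s1 = enters_switch[OF assms(1) p1(1) assms(2) r_sym[OF assms(3)] p1(2)]
  note s2 = enters_switch[OF assms(5) p2(1) assms(6) r_sym[OF assms(7)] p2(2)]
  have "p1 = p2 \<and> q1 = q2"
    using enters_unique[OF s1(1,3) s2(3)] .
  then show ?thesis using s1(4) s2(4) by metis
qed

definition component :: "'a set set \<Rightarrow> 'a \<Rightarrow> 'a set" where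
  "component D u = {x \<in> V. con D u x}"

lemma switch_component:
  assumes "D \<in> forest_sets V r" "\<not> con D u v" "(v, q') \<in> r" "switch D y u q' D' q"
  shows "component D' u \<union> component D' v = component D u \<union> component D v"
proof -
  obtain p where p: "enters D y u p q" "D' = insert {p, q'} (D - {{p, q}})"
    using assms(4) unfolding switch_def by blast
  show ?thesis
    using enters_switch(5)[OF assms(1) p(1) assms(2) r_sym[OF assms(3)] p(2)]
    unfolding component_def by blast
qed

text \<open>The condition sees only the union of the two components, which switching preserves. The
  trivial condition serves to count all forests, the condition \<open>K = V\<close> to count the
  connected ones.\<close>

definition separated :: "('a set \<Rightarrow> bool) \<Rightarrow> 'a \<Rightarrow> 'a \<Rightarrow> 'a set set set" where
  "separated \<Phi> u v =
     {D \<in> forest_sets V r. \<not> con D u v \<and> \<Phi> (component D u \<union> component D v)}"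

lemma finite_component [simp]: "finite (component D u)"
  using finite_verts by (simp add: component_def)

lemma finite_separated [simp]: "finite (separated \<Phi> u v)"
  using finite_forest_sets by (simp add: separated_def)

lemma finite_class [simp]: "finite (r `` {u})"
  using finite_verts by (rule finite_subset[rotated]) (auto dest: r_in)

lemma class_subset_component: "r `` {u} \<subseteq> component D u"
  by (auto simp: component_def dest: r_in intro: linked_base)

lemma separated_commute: "separated \<Phi> u v = separated \<Phi> v u"
  by (auto simp: separated_def Un_commute dest: con_sym)

text \<open>Switching sends \<open>((D, y), q')\<close> to \<open>((D', y), q)\<close>: the new
  endpoint is chosen in the block of \<open>v\<close>, and the old one in the block of
  \<open>u\<close> is remembered.\<close>

lemma switch_card_le:
  assumes uv: "u \<in> V" "v \<in> V"
  shows "card (SIGMA D:separated \<Phi> u v. component D u - r `` {u}) * card (r `` {v})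
    \<le> card (SIGMA D:separated \<Phi> u v. component D v - r `` {v}) * card (r `` {u})"
proof -
  let ?A = "(SIGMA D:separated \<Phi> u v. component D u - r `` {u}) \<times> r `` {v}"
  let ?B = "(SIGMA D:separated \<Phi> u v. component D v - r `` {v}) \<times> r `` {u}"
  let ?R = "\<lambda>((D, y), q') ((D', y'), q). y = y' \<and> switch D y u q' D' q"
  have "card ?A \<le> card ?B"
  proof (rule card_le_if_inj_on_rel[where r = ?R])
    show "finite ?B" by (intro finite_cartesian_product finite_SigmaI) auto
  next
    fix a assume "a \<in> ?A"
    then obtain D y q' where a: "a = ((D, y), q')" and D: "D \<in> forest_sets V r" "\<not> con D u v"
      and \<Phi>: "\<Phi> (component D u \<union> component D v)"
      and y: "y \<in> V" "con D u y" "(u, y) \<notin> r" and q': "(v, q') \<in> r"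
      by (auto simp: separated_def component_def)
    obtain D' q where sw: "switch D y u q' D' q" "(u, q) \<in> r" "D' \<in> forest_sets V r"
      "\<not> con D' u v" "con D' v y" "(v, y) \<notin> r"
      using switch_exists[OF D y(2,3) uv(1) q'] by blast
    have "((D', y), q) \<in> ?B"
      using sw switch_component[OF D q' sw(1)] y \<Phi> by (simp add: separated_def component_def)
    moreover have "?R a ((D', y), q)" using a sw(1) by simp
    ultimately show "\<exists>b. b \<in> ?B \<and> ?R a b" by blast
  next
    fix a1 a2 b
    assume a: "a1 \<in> ?A" "a2 \<in> ?A" and R: "?R a1 b" "?R a2 b"
    obtain D1 y1 q1 D2 y2 q2 D' y' q where eqs: "a1 = ((D1, y1), q1)" "a2 = ((D2, y2), q2)"
      "b = ((D', y'), q)"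
      by (metis prod.collapse)
    have "switch D1 y' u q1 D' q" "switch D2 y' u q2 D' q" and y: "y1 = y2"
      using R by (auto simp: eqs)
    moreover have "D1 \<in> forest_sets V r" "\<not> con D1 u v" "(v, q1) \<in> r"
      "D2 \<in> forest_sets V r" "\<not> con D2 u v" "(v, q2) \<in> r"
      using a by (simp_all add: eqs separated_def)
    ultimately have "D1 = D2 \<and> q1 = q2" using switch_inj by blast
    then show "a1 = a2" using y by (simp add: eqs)
  qed
  then show ?thesis by (simp only: card_cartesian_product)
qed

section \<open>Joining two components by an edge\<close>

lemma component_insert:
  assumes "con D v z" "con D u y"
  shows "component (insert {z, y} D) u = component D u \<union> component D v"
  unfolding component_def con_insert
  using assms con_sym[of _ _ D] linked_trans[of _ _ r D] linked_refl[of _ r D] by blast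

text \<open>Since the block of \<open>v\<close> is a single vertex, the path from \<open>u\<close>
  enters it by an edge \<open>{y, v}\<close>. Deleting this edge is inverse to joining
  \<open>v\<close> to a vertex \<open>y\<close> of the component of \<open>u\<close>.\<close>

lemma card_joined:
  assumes uv: "u \<in> V" "v \<in> V" "(u, v) \<notin> r" and v: "r `` {v} = {v}"
  shows "card {D \<in> forest_sets V r. con D u v \<and> \<Phi> (component D u)}
    = (\<Sum>D\<in>separated \<Phi> u v. card (component D u))"
proof -
  let ?f = "\<lambda>(D, y). insert {y, v} D"
  have ent: "enters (insert {y, v} D) u v y v \<and> insert {y, v} D - {{y, v}} = D"
    if "\<not> con D u v" "con D u y" for D y
  proof -
    have "{y, v} \<notin> D" using that linked_edge linked_trans by metis
    then show ?thesis using that(2) r_refl[OF uv(2)] by (simp add: enters_def)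
  qed
  have ins: "insert {y, v} D \<in> forest_sets V r"
    if "D \<in> forest_sets V r" "\<not> con D u v" "con D u y" "y \<in> V" for D y
    using that uv linked_trans[of u y r D v] by (intro forest_insert) auto
  have inj: "inj_on ?f (SIGMA D:separated \<Phi> u v. component D u)"
  proof (rule inj_onI, clarify)
    fix D y D' y'
    assume *: "D \<in> separated \<Phi> u v" "y \<in> component D u" "D' \<in> separated \<Phi> u v"
      "y' \<in> component D' u" and eq: "insert {y, v} D = insert {y', v} D'"
    have D: "D \<in> forest_sets V r" "\<not> con D u v" "con D u y" "y \<in> V"
      and D': "\<not> con D' u v" "con D' u y'"
      using * by (auto simp: separated_def component_def)
    have "enters (insert {y, v} D) u v y' v" using ent[OF D'] unfolding eq by blast
    moreover have "enters (insert {y, v} D) u v y v" using ent[OF D(2,3)] by blast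
    ultimately have "y = y'"
      using enters_unique[OF ins[OF D]] by blast
    then show "D = D' \<and> y = y'"
      using ent[OF D(2,3)] ent[OF D'] eq by metis
  qed
  have img: "?f ` (SIGMA D:separated \<Phi> u v. component D u)
      = {D \<in> forest_sets V r. con D u v \<and> \<Phi> (component D u)}"
  proof (intro set_eqI iffI)
    fix E assume "E \<in> ?f ` (SIGMA D:separated \<Phi> u v. component D u)"
    then obtain D y where E: "E = insert {v, y} D" and D: "D \<in> forest_sets V r" "\<not> con D u v"
      "con D u y" "y \<in> V" and \<Phi>: "\<Phi> (component D u \<union> component D v)"
      by (auto simp: separated_def component_def insert_commute)
    have "E \<in> forest_sets V r" using ins[OF D] E by (simp add: insert_commute)
    moreover have "con E u v" unfolding E con_insert using D(3) linked_refl[of v r D] by blast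
    moreover have "\<Phi> (component E u)"
      using \<Phi> component_insert[OF linked_refl D(3), of v] E by simp
    ultimately show "E \<in> {D \<in> forest_sets V r. con D u v \<and> \<Phi> (component D u)}" by blast
  next
    fix E assume "E \<in> {D \<in> forest_sets V r. con D u v \<and> \<Phi> (component D u)}"
    then have E: "E \<in> forest_sets V r" "con E u v" "\<Phi> (component E u)" by auto
    obtain y q where yq: "enters E u v y q" using enters_exists E(2) uv by blast
    moreover have "q = v" using yq v r_sym unfolding enters_def by blast
    ultimately have yv: "{y, v} \<in> E" "con (E - {{y, v}}) u y"
      unfolding enters_def by auto
    define D where "D = E - {{y, v}}"
    have ED: "E = insert {v, y} D" "E = insert {y, v} D"
      using yv(1) unfolding D_def by (auto simp: insert_commute)
    have "\<not> con D y v" using forest_edge(1)[OF E(1) yv(1)] unfolding D_def .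
    then have "\<not> con D u v" using yv(2) con_sym linked_trans unfolding D_def by metis
    moreover have "D \<in> forest_sets V r" unfolding D_def by (rule forest_subset[OF E(1)]) auto
    moreover have "con D u y" "y \<in> V" using yv(2) forest_edge[OF E(1) yv(1)] unfolding D_def by auto
    moreover have "\<Phi> (component D u \<union> component D v)"
      using E(3) component_insert[OF linked_refl \<open>con D u y\<close>, of v] ED(1) by simp
    ultimately have "(D, y) \<in> (SIGMA D:separated \<Phi> u v. component D u)"
      by (simp add: separated_def component_def)
    then show "E \<in> ?f ` (SIGMA D:separated \<Phi> u v. component D u)"
      using ED(2) by (force intro!: rev_image_eqI)
  qed
  have "card {D \<in> forest_sets V r. con D u v \<and> \<Phi> (component D u)}
      = card (SIGMA D:separated \<Phi> u v. component D u)"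
    unfolding img[symmetric] by (rule card_image[OF inj])
  then show ?thesis by (simp add: card_SigmaI)
qed

text \<open>A marked vertex \<open>pick D z\<close> records from which side the block of
  \<open>u\<close> is entered. Switching moves it from the side of \<open>u\<close>
  (\<open>T2\<close>) to that of \<open>z\<close> (\<open>T1\<close>), so
  \<open>card T2 \<le> a * card T1\<close>. In \<open>T1\<close>, an added edge
  \<open>{z, q}\<close> can be recovered as the edge entering from the marked vertex, so
  \<open>a * card T1 \<le> card X\<close>.\<close>

lemma outside_card_le:
  fixes u v :: 'a
  assumes uv: "u \<in> V" "v \<in> V"
  defines "a \<equiv> card (r `` {u})" and "X \<equiv> separated (\<lambda>_. True) u v"
  shows "a * (\<Sum>D\<in>X. card (V - (component D u \<union> component D v))) \<le> (a + 1) * card X"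
proof -
  define T where "T = (SIGMA D:X. V - (component D u \<union> component D v))"
  define pick where "pick D z = (SOME x. x \<in> component D u \<union> component D z - r `` {u})" for D z
  define T1 where "T1 = {(D, z). (D, z) \<in> T \<and> con D z (pick D z)}"
  define T2 where "T2 = {(D, z). (D, z) \<in> T \<and> con D u (pick D z)}"
  have X: "D \<in> X \<longleftrightarrow> D \<in> forest_sets V r \<and> \<not> con D u v" for D
    by (simp add: X_def separated_def)
  have T: "(D, z) \<in> T \<longleftrightarrow> D \<in> forest_sets V r \<and> \<not> con D u v \<and> z \<in> V \<and> \<not> con D u z \<and> \<not> con D v z"
    for D z by (auto simp: T_def X component_def)
  have fin: "finite X" "finite T"
    using finite_verts by (auto simp: T_def X_def intro!: finite_SigmaI)
  have "T1 \<subseteq> T" "T2 \<subseteq> T" by (auto simp: T1_def T2_def)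
  then have finT: "finite T1" "finite T2" using fin by (auto intro: finite_subset)
  have pick: "pick D z \<in> component D u \<union> component D z" "(u, pick D z) \<notin> r" if "(D, z) \<in> T" for D z
  proof -
    \<comment> \<open>The vertex \<open>z\<close> itself is a candidate, so the choice in
      \<open>pick\<close> is from a nonempty set.\<close>
    have "z \<in> component D u \<union> component D z - r `` {u}"
      using that linked_base[of u z r D] linked_refl[of z r D] by (simp add: T component_def, blast)
    then have "pick D z \<in> component D u \<union> component D z - r `` {u}"
      unfolding pick_def by (rule someI)
    then show "pick D z \<in> component D u \<union> component D z" "(u, pick D z) \<notin> r" by auto
  qed
  have "T \<subseteq> T1 \<union> T2"
    using pick by (fastforce simp: T1_def T2_def component_def)
  then have card_T: "card T \<le> card T1 + card T2"
    using finT by (meson card_Un_le card_mono finite_UnI le_trans)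
  \<comment> \<open>The picked vertex depends only on the union of the components of \<open>u\<close> and \<open>z\<close>, which
    switching preserves.\<close>
  have "card T2 \<le> card (T1 \<times> r `` {u})"
  proof (rule card_le_if_inj_on_rel
      [where r = "\<lambda>(D, z) ((D', z'), q). z = z' \<and> switch D (pick D z) u z D' q"])
    show "finite (T1 \<times> r `` {u})" using finT by simp
  next
    fix t assume "t \<in> T2"
    then obtain D z where t: "t = (D, z)" and Dz: "(D, z) \<in> T" "con D u (pick D z)"
      by (auto simp: T2_def)
    have D: "D \<in> forest_sets V r" "\<not> con D u v" "z \<in> V" "\<not> con D u z" "\<not> con D v z"
      using Dz(1) by (simp_all add: T)
    have zz: "(z, z) \<in> r" using D(3) by (rule r_refl)
    obtain D' q where sw: "switch D (pick D z) u z D' q" "(u, q) \<in> r" "D' \<in> forest_sets V r"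
      "\<not> con D' u z" "con D' z (pick D z)"
      using switch_exists[OF D(1) D(4) Dz(2) pick(2)[OF Dz(1)] uv(1) zz] by blast
    have comp: "component D' u \<union> component D' z = component D u \<union> component D z"
      by (rule switch_component[OF D(1) D(4) zz sw(1)])
    then have "pick D' z = pick D z" by (simp add: pick_def)
    moreover have "v \<notin> component D u \<union> component D z"
      using D con_sym[of z v D] by (auto simp: component_def)
    then have "v \<notin> component D' u \<union> component D' z" unfolding comp .
    then have "\<not> con D' u v" "\<not> con D' v z"
      using uv(2) con_sym[of v z D'] unfolding component_def by blast+
    ultimately have "((D', z), q) \<in> T1 \<times> r `` {u}"
      using sw D(3) by (simp add: T1_def T)
    then show "\<exists>b. b \<in> T1 \<times> r `` {u} \<and>
        (case t of (D, z) \<Rightarrow> \<lambda>((D', z'), q). z = z' \<and> switch D (pick D z) u z D' q) b"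
      using sw(1) t by auto
  next
    fix t1 t2 b
    assume t: "t1 \<in> T2" "t2 \<in> T2"
      and R: "(case t1 of (D, z) \<Rightarrow> \<lambda>((D', z'), q). z = z' \<and> switch D (pick D z) u z D' q) b"
        "(case t2 of (D, z) \<Rightarrow> \<lambda>((D', z'), q). z = z' \<and> switch D (pick D z) u z D' q) b"
    obtain D1 z1 D2 z2 D' z q where eqs: "t1 = (D1, z1)" "t2 = (D2, z2)" "b = ((D', z), q)"
      by (metis prod.collapse)
    have z: "z1 = z" "z2 = z" using R by (auto simp: eqs)
    have sw: "switch D1 (pick D1 z) u z D' q" "switch D2 (pick D2 z) u z D' q"
      using R by (auto simp: eqs z)
    have D: "D1 \<in> forest_sets V r" "\<not> con D1 u z" "D2 \<in> forest_sets V r" "\<not> con D2 u z" "z \<in> V"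
      using t by (simp_all add: eqs z T2_def T)
    have zz: "(z, z) \<in> r" using D(5) by (rule r_refl)
    have "pick D1 z = pick D2 z"
      using switch_component[OF D(1,2) zz sw(1)] switch_component[OF D(3,4) zz sw(2)]
      by (simp add: pick_def)
    then have "D1 = D2"
      using switch_inj[OF D(1,2) zz sw(1) D(3,4) zz] sw(2) by simp
    then show "t1 = t2" by (simp add: eqs z)
  qed
  then have T2: "card T2 \<le> card T1 * a" by (simp add: card_cartesian_product a_def)
  have "card (T1 \<times> r `` {u}) \<le> card X"
  proof (rule card_inj_on_le[where f = "\<lambda>((D, z), q). insert {z, q} D"])
    have T1D: "D \<in> forest_sets V r" "\<not> con D u v" "z \<in> V" "\<not> con D u z" "\<not> con D v z"
        "con D z (pick D z)" "q \<in> V" "con D u q" "(q, u) \<in> r"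
      if "(D, z) \<in> T1" "(u, q) \<in> r" for D z q
      using that linked_base[of u q r D] r_sym[of u q] by (auto simp: T1_def T dest: r_in)
    have zq: "\<not> con D z q" if "(D, z) \<in> T1" "(u, q) \<in> r" for D z q
      using T1D[OF that] con_sym[of z q D] linked_trans[of u q r D z] by blast
    have E: "insert {z, q} D \<in> X" if "(D, z) \<in> T1" "(u, q) \<in> r" for D z q
    proof -
      note D = T1D[OF that]
      have "insert {z, q} D \<in> forest_sets V r"
        using D zq[OF that] by (intro forest_insert)
      moreover have "\<not> con (insert {z, q} D) u v"
        unfolding con_insert using D con_sym[of z v D] by blast
      ultimately show ?thesis by (simp add: X)
    qed
    then show "(\<lambda>((D, z), q). insert {z, q} D) ` (T1 \<times> r `` {u}) \<subseteq> X" by auto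
    \<comment> \<open>Written through the component of \<open>u\<close> in the enlarged forest, the
      marked vertex depends on that forest alone, so it can be used for decoding.\<close>
    have ent: "enters (insert {z, q} D) (SOME x. x \<in> component (insert {z, q} D) u - r `` {u}) u z q
        \<and> D = insert {z, q} D - {{z, q}}"
      if "(D, z) \<in> T1" "(u, q) \<in> r" for D z q
    proof -
      note D = T1D[OF that]
      have "component (insert {z, q} D) u = component D u \<union> component D z"
        using linked_refl D(8) by (rule component_insert)
      moreover have "{z, q} \<notin> D" using zq[OF that] linked_edge by metis
      moreover have "con D (pick D z) z" using D(6) by (rule con_sym)
      ultimately show ?thesis
        using D(9) by (simp add: enters_def pick_def)
    qed
    show "inj_on (\<lambda>((D, z), q). insert {z, q} D) (T1 \<times> r `` {u})"
    proof (rule inj_onI)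
      fix s t
      assume st: "s \<in> T1 \<times> r `` {u}" "t \<in> T1 \<times> r `` {u}"
        and eq: "(\<lambda>((D, z), q). insert {z, q} D) s = (\<lambda>((D, z), q). insert {z, q} D) t"
      obtain D1 z1 q1 D2 z2 q2 where eqs: "s = ((D1, z1), q1)" "t = ((D2, z2), q2)"
        by (metis prod.collapse)
      define F where "F = insert {z1, q1} D1"
      have F: "F = insert {z2, q2} D2" using eq by (simp add: eqs F_def)
      have m: "(D1, z1) \<in> T1" "(u, q1) \<in> r" "(D2, z2) \<in> T1" "(u, q2) \<in> r"
        using st by (simp_all add: eqs)
      have "F \<in> forest_sets V r" using E[OF m(1,2)] by (simp add: X F_def)
      then have "z1 = z2 \<and> q1 = q2"
        using ent[OF m(1,2)] ent[OF m(3,4)] unfolding F[symmetric] F_def[symmetric]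
        by (intro enters_unique) blast+
      moreover have "D1 = F - {{z1, q1}}" "D2 = F - {{z2, q2}}"
        using ent[OF m(1,2)] ent[OF m(3,4)] unfolding F[symmetric] F_def[symmetric] by blast+
      ultimately show "s = t" by (simp add: eqs)
    qed
  qed (fact fin)
  then have T1: "card T1 * a \<le> card X" by (simp add: card_cartesian_product a_def)
  have "card T \<le> card T1 * (a + 1)"
    using card_T T2 by (simp add: algebra_simps)
  then have "a * card T \<le> (card T1 * a) * (a + 1)"
    using mult_le_mono2[of "card T" "card T1 * (a + 1)" a] by (simp add: algebra_simps)
  also have "\<dots> \<le> card X * (a + 1)"
    using T1 by (rule mult_le_mono1)
  finally have "a * card T \<le> (a + 1) * card X" by (simp add: mult.commute)
  moreover have "card T = (\<Sum>D\<in>X. card (V - (component D u \<union> component D v)))"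
    unfolding T_def using fin finite_verts by (intro card_SigmaI) auto
  ultimately show ?thesis by simp
qed

section \<open>Component sizes and the two counting estimates\<close>

lemma sum_component_diff:
  assumes "u \<in> V"
  shows "(\<Sum>D\<in>S. card (component D u))
    = (\<Sum>D\<in>S. card (component D u - r `` {u})) + card S * card (r `` {u})"
proof -
  have "card (component D u) = card (component D u - r `` {u}) + card (r `` {u})" for D
    using class_subset_component[of u D]
    by (metis add.commute card_mono card_Diff_subset finite_class finite_component le_add_diff_inverse)
  then show ?thesis by (simp add: sum.distrib)
qed

text \<open>Passing from components without their blocks to full components adds the product of the
  two block sizes to both sides for every forest.\<close>

lemma sum_component_le:
  assumes uv: "u \<in> V" "v \<in> V"
  shows "(\<Sum>D\<in>separated \<Phi> u v. card (component D u)) * card (r `` {v})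
    \<le> (\<Sum>D\<in>separated \<Phi> u v. card (component D v)) * card (r `` {u})"
  using switch_card_le[OF uv, of \<Phi>]
  by (simp add: card_SigmaI sum_component_diff[OF uv(1)] sum_component_diff[OF uv(2)] algebra_simps)

lemma sum_component_eq:
  assumes "u \<in> V" "v \<in> V"
  shows "(\<Sum>D\<in>separated \<Phi> u v. card (component D u)) * card (r `` {v})
    = (\<Sum>D\<in>separated \<Phi> u v. card (component D v)) * card (r `` {u})"
  using sum_component_le[of u v \<Phi>] sum_component_le[of v u \<Phi>] assms
  by (simp add: separated_commute[of \<Phi> v u])

lemma component_disjoint: "\<not> con D u v \<Longrightarrow> component D u \<inter> component D v = {}"
  unfolding component_def using con_sym[of _ _ D] linked_trans[of _ _ r D] by blast

text \<open>Each vertex lies with \<open>u\<close>, with \<open>v\<close> or with neither, so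
  \<open>card V * card X = Su + Sv + So\<close>. With \<open>Su = a * Sv\<close> and
  \<open>a * So \<le> (a + 1) * card X\<close>, multiplying by \<open>a\<close> gives at most
  \<open>(a + 1) * (Su + card X)\<close>, and \<open>Su + card X\<close> counts all forests.\<close>

lemma separated_le_forests:
  assumes uv: "u \<in> V" "v \<in> V" "(u, v) \<notin> r" and v: "r `` {v} = {v}"
  shows "card (r `` {u}) * card V * card (separated (\<lambda>_. True) u v)
    \<le> (card (r `` {u}) + 1) * card (forest_sets V r)"
proof -
  define a X where "a = card (r `` {u})" and "X = separated (\<lambda>_. True) u v"
  define Su Sv where "Su = (\<Sum>D\<in>X. card (component D u))" and "Sv = (\<Sum>D\<in>X. card (component D v))"
  define So where "So = (\<Sum>D\<in>X. card (V - (component D u \<union> component D v)))"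
  have "forest_sets V r = X \<union> {D \<in> forest_sets V r. con D u v \<and> True}"
    "X \<inter> {D \<in> forest_sets V r. con D u v \<and> True} = {}"
    by (auto simp: X_def separated_def)
  then have "card (forest_sets V r) = card X + card {D \<in> forest_sets V r. con D u v \<and> True}"
    using finite_forest_sets by (metis card_Un_disjoint finite_Un)
  then have total: "card (forest_sets V r) = card X + Su"
    using card_joined[OF uv v, of "\<lambda>_. True"] by (simp add: Su_def X_def)
  have eq: "Su = Sv * a"
    using sum_component_eq[OF uv(1,2), of "\<lambda>_. True"] v by (simp add: Su_def Sv_def X_def a_def)
  have "card V = card (component D u) + card (component D v)
      + card (V - (component D u \<union> component D v))" if "D \<in> X" for D
  proof -
    have "component D u \<inter> component D v = {}"
      using that by (intro component_disjoint) (simp add: X_def separated_def)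
    then have "card (component D u \<union> component D v) = card (component D u) + card (component D v)"
      by (intro card_Un_disjoint) auto
    moreover have "component D u \<union> component D v \<subseteq> V" by (auto simp: component_def)
    then have "card V = card (component D u \<union> component D v)
        + card (V - (component D u \<union> component D v))"
      using finite_verts by (simp add: card_Diff_subset card_mono)
    ultimately show ?thesis by simp
  qed
  then have "(\<Sum>D\<in>X. card V) = Su + Sv + So"
    unfolding Su_def Sv_def So_def by (simp add: sum.distrib)
  then have "a * card V * card X = a * Su + a * Sv + a * So"
    by (simp add: algebra_simps)
  also have "a * So \<le> (a + 1) * card X"
    using outside_card_le[OF uv(1,2)] by (simp add: a_def X_def So_def)
  finally show ?thesis
    unfolding total using eq by (simp add: a_def X_def algebra_simps)
qed

text \<open>When the two components cover \<open>V\<close>, no vertex lies outside them, and the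
  computation for all forests becomes an exact identity.\<close>

lemma trees_le_separated:
  assumes uv: "u \<in> V" "v \<in> V" "(u, v) \<notin> r" and v: "r `` {v} = {v}"
  shows "(card (r `` {u}) + 1) * card {D \<in> forest_sets V r. con D u v \<and> component D u = V}
    = card (r `` {u}) * card V * card (separated (\<lambda>K. K = V) u v)"
proof -
  define a X where "a = card (r `` {u})" and "X = separated (\<lambda>K. K = V) u v"
  define Su Sv where "Su = (\<Sum>D\<in>X. card (component D u))" and "Sv = (\<Sum>D\<in>X. card (component D v))"
  have total: "card {D \<in> forest_sets V r. con D u v \<and> component D u = V} = Su"
    using card_joined[OF uv v, of "\<lambda>K. K = V"] by (simp add: Su_def X_def)
  have eq: "Su = Sv * a"
    using sum_component_eq[OF uv(1,2), of "\<lambda>K. K = V"] v by (simp add: Su_def Sv_def X_def a_def)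
  have "card V = card (component D u) + card (component D v)" if "D \<in> X" for D
  proof -
    have "component D u \<inter> component D v = {}" "component D u \<union> component D v = V"
      using that component_disjoint by (simp_all add: X_def separated_def)
    then show ?thesis by (metis card_Un_disjoint finite_component)
  qed
  then have "(\<Sum>D\<in>X. card V) = Su + Sv"
    unfolding Su_def Sv_def by (simp add: sum.distrib)
  then have "a * card V * card X = a * Su + a * Sv"
    by (simp add: algebra_simps)
  then show ?thesis
    unfolding total using eq by (simp add: a_def X_def algebra_simps)
qed

end

section \<open>Splitting blocks\<close>

definition spanning_sets :: "'a set \<Rightarrow> 'a rel \<Rightarrow> 'a set set set" where
  "spanning_sets V r = {D \<in> forest_sets V r. \<forall>x\<in>V. \<forall>y\<in>V. (x, y) \<in> linked r D}"

context vertex_partition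
begin

text \<open>For linking, \<open>s\<close> acts like \<open>r\<close> with \<open>{u, v}\<close>
  permanently present. Its forests are therefore those over \<open>r\<close> to which this edge can
  be added without closing a cycle.\<close>

lemma forest_sets_merge:
  assumes uv: "u \<in> V" "v \<in> V" "(u, v) \<notin> r" and v: "r `` {v} = {v}"
    and merge: "\<And>D. linked s D = linked r (insert {u, v} D)"
  shows "forest_sets V s = separated (\<lambda>_. True) u v"
proof (intro set_eqI iffI)
  fix D assume D: "D \<in> forest_sets V s"
  have nl: "(x, y) \<notin> linked r (insert {u, v} (D - {{x, y}}))" if "{x, y} \<in> D" for x y
    using D that merge by (auto simp: forest_sets_def)
  have "\<not> con (D - {{x, y}}) x y" if "{x, y} \<in> D" for x y
    using nl[OF that] unfolding con_insert by blast
  then have "D \<in> forest_sets V r"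
    using D by (auto simp: forest_sets_def)
  moreover have "\<not> con D u v"
  proof
    assume "con D u v"
    \<comment> \<open>The last edge of a path from \<open>u\<close> to \<open>v\<close> would be
      bypassed by the permanent edge \<open>{u, v}\<close>.\<close>
    then obtain p q where e: "enters D u v p q" using enters_exists uv by blast
    moreover have "q = v" using e v r_sym unfolding enters_def by blast
    ultimately have pv: "{p, v} \<in> D" "con (D - {{p, v}}) u p"
      unfolding enters_def by auto
    have "(p, v) \<in> linked r (insert {u, v} (D - {{p, v}}))"
      using con_sym[OF pv(2)] linked_refl[of v] unfolding con_insert by blast
    then show False using nl[OF pv(1)] by blast
  qed
  ultimately show "D \<in> separated (\<lambda>_. True) u v" by (simp add: separated_def)
next
  fix D assume "D \<in> separated (\<lambda>_. True) u v"
  then have D: "D \<in> forest_sets V r" "\<not> con D u v" by (auto simp: separated_def)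
  then have ins: "insert {u, v} D \<in> forest_sets V r"
    using uv by (intro forest_insert)
  have "(x, y) \<notin> linked s (D - {{x, y}})" if xy: "{x, y} \<in> D" for x y
  proof -
    have "{u, v} \<notin> D" using D(2) linked_edge by metis
    then have "insert {u, v} D - {{x, y}} = insert {u, v} (D - {{x, y}})"
      using xy by auto
    then show ?thesis
      using forest_edge(1)[OF ins, of x y] xy merge by simp
  qed
  then show "D \<in> forest_sets V s"
    using D(1) by (auto simp: forest_sets_def)
qed

text \<open>In cross-multiplied form, merging does not lower the proportion of spanning forests.
  After multiplication by \<open>a + 1\<close>, the exact identity handles the spanning sets, the
  inequality handles all forests, and the factor cancels.\<close>

lemma forest_sets_spanning_sets_merge_le:
  assumes uv: "u \<in> V" "v \<in> V" "(u, v) \<notin> r" and v: "r `` {v} = {v}"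
    and merge: "\<And>D. linked s D = linked r (insert {u, v} D)"
  shows "card (forest_sets V s) * card (spanning_sets V r)
    \<le> card (forest_sets V r) * card (spanning_sets V s)"
proof -
  define a where "a = card (r `` {u})"
  have all: "(\<forall>x\<in>V. \<forall>y\<in>V. con D x y) \<longleftrightarrow> (\<forall>x\<in>V. con D u x)" for D
    using uv(1) con_sym[of _ _ D] linked_trans[of _ _ r D] by blast
  have C1: "spanning_sets V r = {D \<in> forest_sets V r. con D u v \<and> component D u = V}"
    using uv(2) unfolding spanning_sets_def all component_def by blast
  \<comment> \<open>Over \<open>s\<close> the component of \<open>u\<close> is the union of the two
    components over \<open>r\<close>, joined by \<open>{u, v}\<close>.\<close>
  have "(\<forall>x\<in>V. \<forall>y\<in>V. (x, y) \<in> linked s D) \<longleftrightarrow> component D u \<union> component D v = V" for D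
  proof -
    have "(\<forall>x\<in>V. \<forall>y\<in>V. (x, y) \<in> linked s D) \<longleftrightarrow> (\<forall>x\<in>V. con (insert {u, v} D) u x)"
      unfolding merge using uv(1) con_sym[of _ _ "insert {u, v} D"]
        linked_trans[of _ _ r "insert {u, v} D"] by blast
    also have "\<dots> \<longleftrightarrow> component D u \<union> component D v = V"
      unfolding con_insert component_def using linked_refl[of u r D] linked_trans[of u v r D] by blast
    finally show ?thesis .
  qed
  then have C2: "spanning_sets V s = separated (\<lambda>K. K = V) u v"
    unfolding spanning_sets_def forest_sets_merge[OF assms] by (auto simp: separated_def)
  have "(card (forest_sets V s) * card (spanning_sets V r)) * (a + 1)
      = (a * card V * card (forest_sets V s)) * card (spanning_sets V s)"
    using trees_le_separated[OF uv v] unfolding C1[symmetric] C2[symmetric]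
    by (simp add: a_def algebra_simps)
  also have "\<dots> \<le> (a + 1) * card (forest_sets V r) * card (spanning_sets V s)"
    using separated_le_forests[OF uv v] unfolding forest_sets_merge[OF assms, symmetric]
    by (intro mult_le_mono1) (simp add: a_def)
  finally have "(card (forest_sets V s) * card (spanning_sets V r)) * (a + 1)
      \<le> (card (forest_sets V r) * card (spanning_sets V s)) * (a + 1)"
    by (simp add: algebra_simps)
  then show ?thesis by (simp only: mult_le_cancel2)
qed

end

section \<open>Reduction to the discrete partition\<close>

lemma empty_in_forest_sets: "{} \<in> forest_sets V r"
  by (simp add: forest_sets_def)

text \<open>This supplies the hypotheses of the merging step. The other members of the class of
  \<open>v\<close> remain related to \<open>u\<close> and reach \<open>v\<close> over the edge
  \<open>{u, v}\<close>; the strict inclusion drives the induction.\<close>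

lemma split_vertex:
  assumes s: "equiv V s" and uv: "(u, v) \<in> s" "u \<noteq> v"
  defines "r \<equiv> s \<inter> (V - {v}) \<times> (V - {v}) \<union> {(v, v)}"
  shows "equiv V r" "r `` {v} = {v}" "r \<subset> s" "linked s D = linked r (insert {u, v} D)"
proof -
  have sV: "s \<subseteq> V \<times> V" and sr: "\<And>x. x \<in> V \<Longrightarrow> (x, x) \<in> s" and ss: "\<And>x y. (x, y) \<in> s \<Longrightarrow> (y, x) \<in> s"
    and st: "\<And>x y z. (x, y) \<in> s \<Longrightarrow> (y, z) \<in> s \<Longrightarrow> (x, z) \<in> s"
    using s by (auto simp: equiv_def refl_on_def dest: symD transD)
  have vV: "u \<in> V" "v \<in> V" using sV uv by auto
  show "equiv V r"
  proof (rule equivI)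
    show "r \<subseteq> V \<times> V" using sV vV by (auto simp: r_def)
    show "refl_on V r" using sr by (auto simp: r_def refl_on_def)
    show "sym r" using ss by (auto simp: r_def sym_def)
    show "trans r" using st unfolding r_def trans_def by blast
  qed
  show "r `` {v} = {v}" by (auto simp: r_def)
  show "r \<subset> s" using uv sr vV by (auto simp: r_def)
  have "s \<subseteq> linked r (insert {u, v} D)"
  proof (rule subrelI)
    fix x y assume xy: "(x, y) \<in> s"
    have e: "(u, v) \<in> linked r (insert {u, v} D)" "(v, u) \<in> linked r (insert {u, v} D)"
      by (auto intro!: linked_edge simp: insert_commute)
    have u: "(w, u) \<in> linked r (insert {u, v} D)" "(u, w) \<in> linked r (insert {u, v} D)"
      if "(w, u) \<in> s" "w \<noteq> v" for w
      using that uv(2) vV sV ss[OF that(1)] by (auto intro!: linked_base simp: r_def)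
    consider "x = v" "y = v" | "x = v" "y \<noteq> v" | "x \<noteq> v" "y = v" | "x \<noteq> v" "y \<noteq> v" by blast
    then show "(x, y) \<in> linked r (insert {u, v} D)"
    proof cases
      case 1
      then show ?thesis by (simp add: linked_refl)
    next
      case 2
      then have "(y, u) \<in> s" using xy uv ss st by blast
      then show ?thesis using 2 e u linked_trans by metis
    next
      case 3
      then have "(x, u) \<in> s" using xy uv ss st by blast
      then show ?thesis using 3 e u linked_trans by metis
    next
      case 4
      then show ?thesis using xy sV by (auto intro!: linked_base simp: r_def)
    qed
  qed
  moreover have "{(x, y). {x, y} \<in> D} \<subseteq> linked r (insert {u, v} D)"
    by (auto intro: linked_edge)
  ultimately have "linked s D \<subseteq> linked r (insert {u, v} D)"
    unfolding linked_def by (intro rtrancl_subset_rtrancl) auto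
  moreover have "linked r (insert {u, v} D) \<subseteq> linked s D"
    unfolding linked_def using \<open>r \<subset> s\<close> uv(1) ss[OF uv(1)]
    by (intro rtrancl_mono) (auto simp: doubleton_eq_iff)
  ultimately show "linked s D = linked r (insert {u, v} D)" by blast
qed

text \<open>Splitting off one vertex at a time ends at \<open>Id_on V\<close>, where the forests are
  the ordinary ones and the spanning sets are the trees on \<open>V\<close>.\<close>

lemma spanning_fraction_ge_trees:
  assumes fin: "finite V" and "equiv V r"
  shows "card (forest_sets V r) * card (spanning_sets V (Id_on V))
    \<le> card (forest_sets V (Id_on V)) * card (spanning_sets V r)"
  using assms(2)
proof (induction "card r" arbitrary: r rule: less_induct)
  case (less s)
  show ?case
  proof (cases "s = Id_on V")
    case True
    then show ?thesis by simp
  next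
    case False
    have sV: "s \<subseteq> V \<times> V" and "Id_on V \<subseteq> s"
      using less.prems by (auto simp: equiv_def refl_on_def)
    then obtain u v where uv: "(u, v) \<in> s" "u \<noteq> v"
      using False by fastforce
    define r where "r = s \<inter> (V - {v}) \<times> (V - {v}) \<union> {(v, v)}"
    note split = split_vertex[OF less.prems uv, folded r_def]
    interpret vertex_partition V r
      using fin split(1) by unfold_locales
    have "finite s" using sV fin finite_subset by blast
    then have "card r < card s" using split(3) by (rule psubset_card_mono)
    then have IH: "card (forest_sets V r) * card (spanning_sets V (Id_on V))
        \<le> card (forest_sets V (Id_on V)) * card (spanning_sets V r)"
      using less.hyps split(1) by blast
    have "(u, v) \<notin> r" using uv(2) by (auto simp: r_def)
    then have step: "card (forest_sets V s) * card (spanning_sets V r)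
        \<le> card (forest_sets V r) * card (spanning_sets V s)"
      using uv sV split by (intro forest_sets_spanning_sets_merge_le[of u v]) auto
    \<comment> \<open>The intermediate count \<open>?Zr\<close> is a common factor when the two
      cross-multiplied inequalities are chained; the empty forest makes it positive.\<close>
    have Zr: "card (forest_sets V r) > 0"
      using finite_forest_sets empty_in_forest_sets by (auto simp: card_gt_0_iff)
    show ?thesis
    proof (cases "card (spanning_sets V (Id_on V)) = 0")
      case True
      then show ?thesis by simp
    next
      case False
      let ?Zs = "card (forest_sets V s)" and ?Zr = "card (forest_sets V r)"
        and ?Z = "card (forest_sets V (Id_on V))" and ?Cs = "card (spanning_sets V s)"
        and ?Cr = "card (spanning_sets V r)" and ?C = "card (spanning_sets V (Id_on V))"
      have "?Zs * ?C * ?Zr \<le> ?Zs * (?Z * ?Cr)"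
        using IH by (metis mult.assoc mult.commute mult_le_mono2)
      also have "\<dots> \<le> ?Z * (?Zr * ?Cs)"
        using step by (metis mult.assoc mult.commute mult_le_mono2)
      finally have "(?Zs * ?C) * ?Zr \<le> (?Z * ?Cs) * ?Zr" by (simp add: algebra_simps)
      then show ?thesis using Zr by simp
    qed
  qed
qed

section \<open>Bridges of graphs\<close>

text \<open>This local form of \<open>bridge\<close> matches the acyclicity condition in
  \<open>forest_sets\<close>; \<open>bridge_iff_bridges\<close> identifies it with the definition by
  component counts.\<close>

definition bridges :: "'a set set \<Rightarrow> 'a set set" where
  "bridges E = {e \<in> E. \<exists>x y. e = {x, y} \<and> (x, y) \<notin> linked {} (E - {e})}"

definition component_rel :: "'a set \<Rightarrow> 'a set set \<Rightarrow> 'a rel" where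
  "component_rel V E = linked {} E \<inter> V \<times> V"

lemma linked_empty_sym: "(x, y) \<in> linked {} E \<Longrightarrow> (y, x) \<in> linked {} E"
  by (rule linked_sym) (simp add: sym_def)

lemmas linked_empty_insert = linked_insert[of "{}", simplified sym_def, simplified]

lemma bridges_iff:
  "{x, y} \<in> bridges E \<longleftrightarrow> {x, y} \<in> E \<and> (x, y) \<notin> linked {} (E - {{x, y}})"
proof -
  have "(x, y) \<notin> linked {} (E - {{x, y}})"
    if "{x, y} = {a, b}" "(a, b) \<notin> linked {} (E - {{x, y}})" for a b
    using that linked_empty_sym[of x y] by (auto simp: doubleton_eq_iff)
  then show ?thesis unfolding bridges_def by blast
qed

lemma equiv_component_rel: "equiv V (component_rel V E)"
proof (rule equivI)
  show "component_rel V E \<subseteq> V \<times> V" by (auto simp: component_rel_def)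
  show "refl_on V (component_rel V E)" by (auto simp: component_rel_def refl_on_def linked_refl)
  show "sym (component_rel V E)" by (auto simp: component_rel_def sym_def dest: linked_empty_sym)
  show "trans (component_rel V E)"
    unfolding component_rel_def trans_def using linked_trans by fast
qed

lemma reach_eq: "reach G = component_rel (verts G) (edges G)"
  by (simp add: reach_def adj_def component_rel_def linked_def)

text \<open>Linking does not distinguish a graph from its component relation, so forests over that
  relation are exactly what can be laid on top of the graph.\<close>

lemma linked_component_rel:
  assumes "\<And>e. e \<in> E \<Longrightarrow> e \<subseteq> V"
  shows "linked (component_rel V E) D = linked {} (E \<union> D)"
proof
  show "linked (component_rel V E) D \<subseteq> linked {} (E \<union> D)"
    unfolding linked_def[of "component_rel V E"]
  proof (rule rtrancl_subset_rtrancl[of _ "{(x, y). {x, y} \<in> E \<union> D}", folded linked_def[of "{}", simplified]])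
    show "component_rel V E \<union> {(x, y). {x, y} \<in> D} \<subseteq> linked {} (E \<union> D)"
      using linked_mono[of E "E \<union> D" _ _ "{}"]
      by (auto simp: component_rel_def intro: linked_edge)
  qed
  have "{x, y} \<in> E \<Longrightarrow> (x, y) \<in> component_rel V E" for x y
    using assms[of "{x, y}"] by (simp add: component_rel_def linked_edge)
  then show "linked {} (E \<union> D) \<subseteq> linked (component_rel V E) D"
    unfolding linked_def by (intro rtrancl_mono) auto
qed

lemma linked_Id_on: "linked (Id_on V) D = linked {} D"
proof -
  have "linked (Id_on V) D = (({(x, y). {x, y} \<in> D} \<union> Id_on V)\<^sup>*)"
    by (simp add: linked_def Un_commute)
  also have "\<dots> = {(x, y). {x, y} \<in> D}\<^sup>*"
    by (rule rtrancl_subset) auto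
  finally show ?thesis by (simp add: linked_def)
qed

text \<open>The detour around a non-bridge uses no bridge: closed up by \<open>{x, y}\<close>, it
  would bypass any bridge \<open>f\<close> on it. Hence the bridges in \<open>S\<close> can be
  removed one by one.\<close>

lemma not_bridge_in_core:
  assumes fin: "finite S" and S: "S \<subseteq> bridges E" and xy: "{x, y} \<in> E" "{x, y} \<notin> bridges E"
  shows "(x, y) \<in> linked {} (E - {{x, y}} - S)"
  using fin S
proof (induction S rule: finite_induct)
  case empty
  then show ?case using xy bridges_iff[of x y E] by simp
next
  case (insert f S)
  define R where "R = E - {{x, y}} - insert f S"
  obtain s t where f: "f = {s, t}" and fE: "f \<in> E" and st: "(s, t) \<notin> linked {} (E - {f})"
    using insert.prems unfolding bridges_def by blast
  have fxy: "f \<noteq> {x, y}" using insert.prems xy(2) by auto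
  have eq: "E - {{x, y}} - S = insert {s, t} R"
    using fxy insert.hyps(2) fE unfolding R_def f by auto
  have "(x, y) \<in> linked {} (E - {{x, y}} - S)"
    using insert.IH insert.prems by blast
  then have cs: "(x, y) \<in> linked {} R \<or> (x, s) \<in> linked {} R \<and> (t, y) \<in> linked {} R
      \<or> (x, t) \<in> linked {} R \<and> (s, y) \<in> linked {} R"
    unfolding eq linked_empty_insert .
  have mono: "(p, q) \<in> linked {} (E - {f})" if "(p, q) \<in> linked {} R" for p q
    by (rule linked_mono[OF _ that]) (auto simp: R_def)
  have e: "(x, y) \<in> linked {} (E - {f})" "(y, x) \<in> linked {} (E - {f})"
    using xy(1) fxy by (auto intro!: linked_edge simp: insert_commute)
  have "\<not> ((x, s) \<in> linked {} R \<and> (t, y) \<in> linked {} R)"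
    "\<not> ((x, t) \<in> linked {} R \<and> (s, y) \<in> linked {} R)"
    using mono e st linked_empty_sym linked_trans by metis+
  then show ?case using cs unfolding R_def by blast
qed

lemma bridges_core:
  assumes "finite E" and card2: "\<And>e. e \<in> E \<Longrightarrow> card e = 2"
  shows "bridges (E - bridges E) = {}"
proof (rule equals0I)
  fix e assume e: "e \<in> bridges (E - bridges E)"
  then obtain x y where exy: "e = {x, y}" by (auto simp: bridges_def)
  have eE: "{x, y} \<in> E" "{x, y} \<notin> bridges E"
    and n: "(x, y) \<notin> linked {} (E - bridges E - {{x, y}})"
    using e bridges_iff[of x y "E - bridges E"] exy by auto
  have "finite (bridges E)" using assms(1) by (simp add: bridges_def)
  then have "(x, y) \<in> linked {} (E - {{x, y}} - bridges E)"
    using eE by (intro not_bridge_in_core) auto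
  then show False using n unfolding Diff_eq by (simp add: Int_ac)
qed

lemma finite_edges: "simple_graph G \<Longrightarrow> finite (edges G)"
  by (rule finite_subset[of _ "Pow (verts G)"]) (auto simp: simple_graph_def)

text \<open>Deleting \<open>e\<close> refines the component relation \<open>s\<close> to
  \<open>r\<close>, and taking images under \<open>s\<close> maps the classes of \<open>r\<close>
  onto those of \<open>s\<close>. Unlinked ends yield two classes with the same image, hence
  strictly more components; linked ends give \<open>r = s\<close>.\<close>

lemma bridge_iff_bridges:
  assumes G: "simple_graph G"
  shows "bridge G e \<longleftrightarrow> e \<in> bridges (edges G)"
proof (cases "e \<in> edges G")
  case False
  then show ?thesis by (simp add: bridge_def bridges_def)
next
  case True
  define V E where "V = verts G" and "E = edges G"
  have fin: "finite V" using G by (simp add: simple_graph_def V_def)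
  have "card e = 2" "e \<subseteq> V" using G True by (auto simp: simple_graph_def V_def)
  then obtain x y where e: "e = {x, y}" "x \<in> V" "y \<in> V" by (auto simp: card_2_iff)
  define r s where "r = component_rel V (E - {e})" and "s = component_rel V E"
  have eq: "equiv V r" "equiv V s" by (simp_all add: r_def s_def equiv_component_rel)
  have comps: "graph_components G = V // s" "graph_components (delete_edge G e) = V // r"
    by (simp_all add: graph_components_def reach_eq V_def E_def s_def r_def delete_edge_def)
  have finr: "finite (V // r)" using fin eq(1) by (simp add: finite_quotient equiv_def)
  have rs: "r \<subseteq> s" using linked_mono[of "E - {e}" E _ _ "{}"] by (auto simp: r_def s_def component_rel_def)
  have cls: "s `` (r `` {x}) = s `` {x}" if "x \<in> V" for x
    using that eq rs by (auto simp: equiv_def refl_on_def dest: transD)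
  have img: "(``) s ` (V // r) = V // s"
    using cls by (auto simp: quotient_def image_iff)
  have "(x, y) \<in> s" using True e by (auto simp: s_def component_rel_def E_def intro: linked_edge)
  show ?thesis
  proof (cases "(x, y) \<in> linked {} (E - {e})")
    case True
    have "linked {} E \<subseteq> linked {} (E - {e})"
    proof (rule subrelI)
      fix a b assume ab: "(a, b) \<in> linked {} E"
      have "E = insert {x, y} (E - {e})" using \<open>e \<in> edges G\<close> e by (auto simp: E_def)
      then have "(a, b) \<in> linked {} (insert {x, y} (E - {e}))" using ab by simp
      then show "(a, b) \<in> linked {} (E - {e})"
        using True linked_empty_sym[OF True] linked_trans[of _ _ "{}" "E - {e}"]
        unfolding linked_empty_insert by blast
    qed
    then have "r = s" using rs by (auto simp: r_def s_def component_rel_def)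
    then have "\<not> bridge G e" by (simp add: bridge_def comps)
    moreover have "e \<notin> bridges E" using True bridges_iff[of x y E] e(1) by simp
    ultimately show ?thesis by (simp add: E_def)
  next
    case False
    then have "(x, y) \<notin> r" by (simp add: r_def component_rel_def)
    then have "r `` {x} \<noteq> r `` {y}" using eq(1) e by (simp add: eq_equiv_class_iff)
    moreover have "s `` (r `` {x}) = s `` (r `` {y})"
      using \<open>(x, y) \<in> s\<close> eq(2) e cls by (simp add: eq_equiv_class_iff)
    ultimately have "\<not> inj_on ((``) s) (V // r)"
      using quotientI[OF e(2), of r] quotientI[OF e(3), of r] unfolding inj_on_def by blast
    then have "card ((``) s ` (V // r)) \<noteq> card (V // r)"
      using finr eq_card_imp_inj_on by blast
    then have "card (V // s) < card (V // r)"
      using card_image_le[OF finr, of "(``) s"] img by simp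
    then have "bridge G e" using \<open>e \<in> edges G\<close> by (simp add: bridge_def comps)
    moreover have "e \<in> bridges E"
      using False bridges_iff[of x y E] e(1) \<open>e \<in> edges G\<close> by (simp add: E_def)
    ultimately show ?thesis by (simp add: E_def)
  qed
qed

lemma edge_in_forest_set:
  assumes "D \<in> forest_sets V r" "e \<in> D"
  obtains x y where "e = {x, y}" "x \<in> V" "y \<in> V" "x \<noteq> y" "(x, y) \<notin> linked r (D - {e})"
proof -
  obtain x y where e: "e = {x, y}" "x \<in> V" "y \<in> V"
    using assms by (auto simp: forest_sets_def)
  then have "(x, y) \<notin> linked r (D - {e})" using assms by (simp add: forest_sets_def)
  then show thesis using that e linked_refl by metis
qed

section \<open>The fibres of bridge deletion\<close>

lemma forest_union_bridges:
  assumes H: "simple_graph \<lparr>verts = V, edges = H\<rparr>" and D: "D \<in> forest_sets V (component_rel V H)"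
  shows "simple_graph \<lparr>verts = V, edges = H \<union> D\<rparr>" "H \<inter> D = {}" "D \<subseteq> bridges (H \<union> D)"
proof -
  have HV: "e \<subseteq> V" if "e \<in> H" for e using H that by (simp add: simple_graph_def)
  have D': "\<exists>x y. e = {x, y} \<and> x \<in> V \<and> y \<in> V \<and> x \<noteq> y \<and> (x, y) \<notin> linked {} (H \<union> (D - {e}))"
    if e: "e \<in> D" for e
    using edge_in_forest_set[OF D e] linked_component_rel[of H V, OF HV] by metis
  show "simple_graph \<lparr>verts = V, edges = H \<union> D\<rparr>"
    using H D' by (fastforce simp: simple_graph_def)
  show disj: "H \<inter> D = {}"
  proof (rule equals0I)
    fix e assume e: "e \<in> H \<inter> D"
    then obtain x y where "e = {x, y}" "(x, y) \<notin> linked {} (H \<union> (D - {e}))" using D' by blast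
    then show False using linked_edge[of x y "H \<union> (D - {e})" "{}"] e by simp
  qed
  show "D \<subseteq> bridges (H \<union> D)"
  proof
    fix e assume e: "e \<in> D"
    then have "H \<union> D - {e} = H \<union> (D - {e})" using disj by auto
    then show "e \<in> bridges (H \<union> D)" using D'[OF e] e by (auto simp: bridges_def)
  qed
qed

text \<open>The edges of \<open>D\<close> can be added one at a time, and each is a bridge at the
  moment it is added.\<close>

lemma bridge_alterable_forest_union:
  assumes A: "bridge_alterable A" and H: "simple_graph \<lparr>verts = V, edges = H\<rparr>"
    and D: "D \<in> forest_sets V (component_rel V H)"
  shows "\<lparr>verts = V, edges = H \<union> D\<rparr> \<in> A \<longleftrightarrow> \<lparr>verts = V, edges = H\<rparr> \<in> A"
proof -
  interpret vertex_partition V "component_rel V H"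
    using H by unfold_locales (simp_all add: simple_graph_def equiv_component_rel)
  have "finite D"
    using finite_edges[OF forest_union_bridges(1)[OF H D]] by simp
  then show ?thesis
    using D
  proof (induction D rule: finite_induct)
    case empty
    then show ?case by simp
  next
    case (insert e D)
    let ?G = "\<lparr>verts = V, edges = H \<union> insert e D\<rparr>"
    have D: "D \<in> forest_sets V (component_rel V H)"
      using insert.prems by (rule forest_subset) auto
    note f = forest_union_bridges[OF H insert.prems]
    have "bridge ?G e" using f(3) unfolding bridge_iff_bridges[OF f(1)] by simp
    then have "?G \<in> A \<longleftrightarrow> delete_edge ?G e \<in> A"
      using A f(1) unfolding bridge_alterable_def by blast
    moreover have "H \<union> insert e D - {e} = H \<union> D" using f(2) insert.hyps(2) by auto
    ultimately show ?case using insert.IH[OF D] by (simp add: delete_edge_def)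
  qed
qed

text \<open>The bridges of a graph form a forest over the components of its core. Conversely, adding
  any such forest to \<open>H\<close> stays in the class and creates exactly the new edges as
  bridges.\<close>

lemma fibre_eq:
  fixes V :: "nat set"
  assumes A: "bridge_alterable A"
  defines "S \<equiv> {F. \<lparr>verts = V, edges = F\<rparr> \<in> A \<and> simple_graph \<lparr>verts = V, edges = F\<rparr>}"
  assumes E: "E \<in> S" and H: "H = E - bridges E"
  shows "{F \<in> S. F - bridges F = H} = (\<union>) H ` forest_sets V (component_rel V H)"
    and "inj_on ((\<union>) H) (forest_sets V (component_rel V H))"
    and "simple_graph \<lparr>verts = V, edges = H\<rparr>"
proof -
  have sE: "simple_graph \<lparr>verts = V, edges = E\<rparr>" using E by (simp add: S_def)
  then show sH: "simple_graph \<lparr>verts = V, edges = H\<rparr>" by (simp add: simple_graph_def H)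
  have HV: "e \<subseteq> V" if "e \<in> H" for e using sH that by (simp add: simple_graph_def)
  have bH: "bridges H = {}"
    unfolding H using finite_edges[OF sE] sE by (intro bridges_core) (simp_all add: simple_graph_def)
  have core: "bridges F \<in> forest_sets V (component_rel V H) \<and> F = H \<union> bridges F"
    if F: "simple_graph \<lparr>verts = V, edges = F\<rparr>" "F - bridges F = H" for F
  proof -
    have FH: "F = H \<union> bridges F" using F(2) by (auto simp: bridges_def)
    have "bridges F \<subseteq> {{x, y} | x y. x \<in> V \<and> y \<in> V}"
    proof
      fix e assume "e \<in> bridges F"
      then have "card e = 2" "e \<subseteq> V" using F(1) by (auto simp: bridges_def simple_graph_def)
      then show "e \<in> {{x, y} | x y. x \<in> V \<and> y \<in> V}" by (fastforce simp: card_2_iff)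
    qed
    moreover have "(x, y) \<notin> linked (component_rel V H) (bridges F - {{x, y}})"
      if xy: "{x, y} \<in> bridges F" for x y
    proof -
      have "{x, y} \<notin> H" using xy F(2) by auto
      then have "H \<union> (bridges F - {{x, y}}) = F - {{x, y}}" using FH by auto
      then show ?thesis
        using xy linked_component_rel[of H V, OF HV] bridges_iff[of x y F] by simp
    qed
    ultimately show ?thesis using FH by (simp add: forest_sets_def)
  qed
  have HA: "\<lparr>verts = V, edges = H\<rparr> \<in> A"
  proof -
    have c: "bridges E \<in> forest_sets V (component_rel V H)" "E = H \<union> bridges E"
      using core[OF sE] H by blast+
    have "\<lparr>verts = V, edges = E\<rparr> \<in> A" using E by (simp add: S_def)
    then show ?thesis using bridge_alterable_forest_union[OF A sH c(1)] c(2) by simp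
  qed
  show "{F \<in> S. F - bridges F = H} = (\<union>) H ` forest_sets V (component_rel V H)"
  proof (intro set_eqI iffI)
    fix F assume "F \<in> {F \<in> S. F - bridges F = H}"
    then show "F \<in> (\<union>) H ` forest_sets V (component_rel V H)"
      using core[of F] by (auto simp: S_def)
  next
    fix F assume "F \<in> (\<union>) H ` forest_sets V (component_rel V H)"
    then obtain D where F: "F = H \<union> D" and D: "D \<in> forest_sets V (component_rel V H)" by blast
    note f = forest_union_bridges[OF sH D]
    have "e \<notin> bridges F" if e: "e \<in> H" for e
    proof -
      have "card e = 2" using sH e by (simp add: simple_graph_def)
      then obtain x y where xy: "e = {x, y}" by (auto simp: card_2_iff)
      \<comment> \<open>The core is bridgeless, so a core edge keeps its detour in the larger
        graph.\<close>
      then have "(x, y) \<in> linked {} (H - {{x, y}})" using bH e bridges_iff[of x y H] by blast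
      then have "(x, y) \<in> linked {} (F - {{x, y}})" by (rule linked_mono[rotated]) (auto simp: F)
      then show ?thesis using bridges_iff[of x y F] xy by blast
    qed
    then have "F - bridges F = H" using f(2,3) unfolding F by blast
    moreover have "F \<in> S"
      using f(1) bridge_alterable_forest_union[OF A sH D] HA by (simp add: S_def F)
    ultimately show "F \<in> {F \<in> S. F - bridges F = H}" by blast
  qed
  show "inj_on ((\<union>) H) (forest_sets V (component_rel V H))"
    using forest_union_bridges(2)[OF sH] by (intro inj_onI) blast
qed

section \<open>Cycles, bridges and ordinary forests\<close>

text \<open>A walk that returns to a listed vertex is cut back to it. The resulting list has the
  form that \<open>is_cycle\<close> requires, up to the closing edge.\<close>

lemma linked_distinct_path:
  assumes "(x, y) \<in> linked {} D"
  shows "\<exists>xs. xs \<noteq> [] \<and> hd xs = x \<and> last xs = y \<and> distinct xs \<and>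
    (\<forall>i. Suc i < length xs \<longrightarrow> {xs ! i, xs ! Suc i} \<in> D)"
proof -
  have "(x, y) \<in> {(x, y). {x, y} \<in> D}\<^sup>*" using assms by (simp add: linked_def)
  then show ?thesis
  proof (induction rule: rtrancl_induct)
    case base
    show ?case by (rule exI[of _ "[x]"]) simp
  next
    case (step y z)
    then obtain xs where xs: "xs \<noteq> []" "hd xs = x" "last xs = y" "distinct xs"
      "\<And>i. Suc i < length xs \<Longrightarrow> {xs ! i, xs ! Suc i} \<in> D" by blast
    show ?case
    proof (cases "z \<in> set xs")
      case True
      then obtain i where i: "i < length xs" "xs ! i = z" by (auto simp: in_set_conv_nth)
      then have "last (take (Suc i) xs) = z" by (simp add: take_Suc_conv_app_nth)
      then show ?thesis
        using xs by (intro exI[of _ "take (Suc i) xs"]) (auto simp: hd_take)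
    next
      case False
      have "{(xs @ [z]) ! i, (xs @ [z]) ! Suc i} \<in> D" if "Suc i < length (xs @ [z])" for i
      proof (cases "Suc i < length xs")
        case True
        then show ?thesis using xs(5) by (simp add: nth_append)
      next
        case False
        then have "i = length xs - 1" "i < length xs" using that xs(1) by auto
        then have "xs ! i = y" using xs(1,3) by (simp add: last_conv_nth)
        then show ?thesis using step.hyps(2) \<open>i < length xs\<close> \<open>i = length xs - 1\<close> xs(1)
          by (simp add: nth_append)
      qed
      then show ?thesis
        using xs False by (intro exI[of _ "xs @ [z]"]) auto
    qed
  qed
qed

lemma cycle_iff_not_all_bridges:
  assumes G: "simple_graph G"
  shows "(\<exists>c. is_cycle G c) \<longleftrightarrow> bridges (edges G) \<noteq> edges G"
proof
  assume "\<exists>c. is_cycle G c"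
  then obtain c where c: "length c \<ge> 3" "distinct c"
    "\<And>i. i < length c \<Longrightarrow> {c ! i, c ! (Suc i mod length c)} \<in> edges G"
    unfolding is_cycle_def by blast
  define k where "k = length c - 1"
  have k: "length c = Suc k" "k \<ge> 2" using c(1) by (auto simp: k_def)
  have e: "{c ! 0, c ! k} \<in> edges G" using c(3)[of k] k by (simp add: insert_commute)
  have "(c ! 0, c ! j) \<in> linked {} (edges G - {{c ! 0, c ! k}})" if "j \<le> k" for j
    using that
  proof (induction j)
    case 0
    then show ?case by (simp add: linked_refl)
  next
    case (Suc j)
    have "{c ! j, c ! Suc j} \<in> edges G" using c(3)[of j] Suc.prems k by simp
    \<comment> \<open>Here \<open>k \<ge> 2\<close> matters: with two vertices, the step would be
      the closing edge itself.\<close>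
    moreover have "{c ! j, c ! Suc j} \<noteq> {c ! 0, c ! k}"
      using Suc.prems k c(2) by (auto simp: doubleton_eq_iff nth_eq_iff_index_eq)
    ultimately have "(c ! j, c ! Suc j) \<in> linked {} (edges G - {{c ! 0, c ! k}})"
      by (intro linked_edge) simp
    then show ?case using Suc.IH Suc.prems linked_trans by (metis Suc_leD)
  qed
  then have "{c ! 0, c ! k} \<notin> bridges (edges G)"
    unfolding bridges_iff by blast
  then show "bridges (edges G) \<noteq> edges G" using e by blast
next
  assume "bridges (edges G) \<noteq> edges G"
  moreover have "bridges (edges G) \<subseteq> edges G" by (auto simp: bridges_def)
  ultimately obtain e where e: "e \<in> edges G" "e \<notin> bridges (edges G)" by blast
  have "card e = 2" using e G by (simp add: simple_graph_def)
  then obtain x y where xy: "e = {x, y}" "x \<noteq> y" by (auto simp: card_2_iff)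
  then have "(x, y) \<in> linked {} (edges G - {{x, y}})" using e bridges_iff[of x y] by blast
  then obtain c where c: "c \<noteq> []" "hd c = x" "last c = y" "distinct c"
    and p: "\<And>i. Suc i < length c \<Longrightarrow> {c ! i, c ! Suc i} \<in> edges G - {{x, y}}"
    using linked_distinct_path by metis
  define k where "k = length c - 1"
  have k: "length c = Suc k" "c ! 0 = x" "c ! k = y"
    using c by (simp_all add: k_def hd_conv_nth last_conv_nth)
  have "k \<noteq> 0" using k(2,3) xy(2) by metis
  \<comment> \<open>A path with a single edge would use \<open>{x, y}\<close>, which has been
    removed.\<close>
  moreover have "k \<noteq> 1" using p[of 0] k by auto
  ultimately have "length c \<ge> 3" using k by simp
  moreover have "{c ! i, c ! (Suc i mod length c)} \<in> edges G" if "i < length c" for i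
  proof (cases "Suc i < length c")
    case True
    then show ?thesis using p[of i] by simp
  next
    case False
    then have "i = k" using that k by simp
    then show ?thesis using k e xy by (simp add: insert_commute)
  qed
  ultimately show "\<exists>c. is_cycle G c" using c(4) unfolding is_cycle_def by blast
qed

text \<open>Over \<open>Id_on V\<close> linking is ordinary connectivity, so the condition says that
  every edge is a bridge, which is acyclicity.\<close>

lemma forest_iff_forest_sets:
  assumes "finite V"
  shows "\<lparr>verts = V, edges = F\<rparr> \<in> forests \<longleftrightarrow> F \<in> forest_sets V (Id_on V)"
proof
  assume "\<lparr>verts = V, edges = F\<rparr> \<in> forests"
  then have s: "simple_graph \<lparr>verts = V, edges = F\<rparr>" and "\<not> (\<exists>c. is_cycle \<lparr>verts = V, edges = F\<rparr> c)"
    by (auto simp: forests_def)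
  then have b: "bridges F = F" using cycle_iff_not_all_bridges[OF s] by simp
  have "F \<subseteq> {{x, y} | x y. x \<in> V \<and> y \<in> V}"
    using s by (fastforce simp: simple_graph_def card_2_iff)
  then show "F \<in> forest_sets V (Id_on V)"
    using b bridges_iff[of _ _ F] by (auto simp: forest_sets_def linked_Id_on)
next
  assume F: "F \<in> forest_sets V (Id_on V)"
  have "e \<subseteq> V \<and> card e = 2" if "e \<in> F" for e
    using edge_in_forest_set[OF F that] by (metis card_2_iff empty_subsetI insert_subset)
  then have s: "simple_graph \<lparr>verts = V, edges = F\<rparr>"
    using assms by (simp add: simple_graph_def)
  have "e \<in> bridges F" if "e \<in> F" for e
    using edge_in_forest_set[OF F that] that unfolding bridges_def linked_Id_on by blast
  then have "bridges F = F" by (auto simp: bridges_def)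
  then show "\<lparr>verts = V, edges = F\<rparr> \<in> forests"
    using s cycle_iff_not_all_bridges[OF s] by (simp add: forests_def)
qed

lemma connected_graph_iff_linked:
  "connected_graph \<lparr>verts = V, edges = F\<rparr> \<longleftrightarrow> V \<noteq> {} \<and> (\<forall>x\<in>V. \<forall>y\<in>V. (x, y) \<in> linked {} F)"
  by (auto simp: connected_graph_def reach_eq component_rel_def)

section \<open>From counting to probabilities\<close>

lemma prob_connected_eq:
  assumes A: "graph_class A" and ne: "graphs_on A n \<noteq> {}"
  defines "S \<equiv> {F. \<lparr>verts = {1..n}, edges = F\<rparr> \<in> A \<and> simple_graph \<lparr>verts = {1..n}, edges = F\<rparr>}"
  shows "prob_connected A n
      = card {F \<in> S. connected_graph \<lparr>verts = {1..n}, edges = F\<rparr>} / card S"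
    and "finite S" "S \<noteq> {}"
proof -
  let ?g = "\<lambda>F. \<lparr>verts = {1..n}, edges = F\<rparr>"
  have fin: "finite (graphs_on A n)" using A by (rule finite_graphs_on)
  have img: "graphs_on A n = ?g ` S"
  proof (intro set_eqI iffI)
    fix G assume G: "G \<in> graphs_on A n"
    then have "G = ?g (edges G)" "simple_graph G" "G \<in> A"
      using A by (auto simp: graphs_on_def graph_class_def)
    then show "G \<in> ?g ` S" unfolding S_def by (metis (mono_tags, lifting) image_eqI mem_Collect_eq)
  qed (auto simp: graphs_on_def S_def)
  have inj: "inj_on ?g T" for T by (auto simp: inj_on_def)
  show "finite S" using fin inj unfolding img by (metis finite_imageD)
  show "S \<noteq> {}" using ne img by auto
  have "graphs_on A n \<inter> {G. connected_graph G} = ?g ` {F \<in> S. connected_graph (?g F)}"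
    unfolding img by auto
  then have "card (graphs_on A n \<inter> {G. connected_graph G}) = card {F \<in> S. connected_graph (?g F)}"
    using card_image[OF inj] by metis
  moreover have "card (graphs_on A n) = card S"
    unfolding img by (rule card_image[OF inj])
  ultimately show "prob_connected A n = card {F \<in> S. connected_graph (?g F)} / card S"
    unfolding prob_connected_def using measure_pmf_of_set[OF ne fin] by simp
qed

text \<open>On each fibre of \<open>core\<close>, the comparison with trees holds in
  cross-multiplied form with the same constants \<open>C\<close> and \<open>Z\<close>, so it can be
  summed over all cores.\<close>

lemma prob_connected_ge_forests:
  assumes A: "graph_class A" "bridge_alterable A" and n: "n \<ge> 1" and ne: "graphs_on A n \<noteq> {}"
  shows "prob_connected A n \<ge> prob_connected forests n"
proof -
  define V where "V = {1..n}"
  have V: "finite V" "V \<noteq> {}" using n by (auto simp: V_def)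
  define g where "g F = \<lparr>verts = V, edges = F\<rparr>" for F
  define S where "S = {F. g F \<in> A \<and> simple_graph (g F)}"
  define K where "K = {F \<in> S. connected_graph (g F)}"
  define core where "core F = F - bridges F" for F :: "nat set set"
  define Z C where "Z = card (forest_sets V (Id_on V))" and "C = card (spanning_sets V (Id_on V))"
  note pA = prob_connected_eq[OF A(1) ne, folded V_def, folded g_def, folded S_def, folded K_def]
  have "graph_class forests" by (simp add: graph_class_def forests_def)
  note pF = prob_connected_eq[OF this forests_on_finite_nonempty(2)[of n], folded V_def, folded g_def]
  have forests: "{F. g F \<in> forests \<and> simple_graph (g F)} = forest_sets V (Id_on V)"
    using forest_iff_forest_sets[OF V(1)] by (auto simp: forests_def g_def)
  have trees: "{F \<in> forest_sets V (Id_on V). connected_graph (g F)} = spanning_sets V (Id_on V)"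
    using V(2) by (simp add: spanning_sets_def g_def connected_graph_iff_linked linked_Id_on)
  have fibre: "card {F \<in> S. core F = H} * C \<le> Z * card {F \<in> K. core F = H}"
    if H: "H \<in> core ` S" for H
  proof -
    obtain E where E: "E \<in> S" "H = E - bridges E" using H by (auto simp: core_def)
    note f = fibre_eq[OF A(2), of E V H, folded g_def, folded S_def, OF E]
    let ?r = "component_rel V H"
    have HV: "e \<subseteq> V" if "e \<in> H" for e using f(3) that by (simp add: simple_graph_def g_def)
    have linked: "linked ?r D = linked {} (H \<union> D)" for D
      using HV by (rule linked_component_rel)
    have S: "{F \<in> S. core F = H} = (\<union>) H ` forest_sets V ?r"
      using f(1) by (simp add: core_def)
    have "{F \<in> K. core F = H} = {F \<in> {F \<in> S. core F = H}. connected_graph (g F)}"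
      by (auto simp: K_def)
    also have "\<dots> = (\<union>) H ` spanning_sets V ?r"
    proof -
      have "connected_graph (g (H \<union> D)) \<longleftrightarrow> (\<forall>x\<in>V. \<forall>y\<in>V. (x, y) \<in> linked ?r D)" for D
        using V(2) by (simp add: g_def connected_graph_iff_linked linked)
      then show ?thesis unfolding S spanning_sets_def by blast
    qed
    finally have K: "{F \<in> K. core F = H} = (\<union>) H ` spanning_sets V ?r" .
    have "card {F \<in> S. core F = H} = card (forest_sets V ?r)"
      unfolding S by (rule card_image[OF f(2)])
    moreover have "card {F \<in> K. core F = H} = card (spanning_sets V ?r)"
      unfolding K by (rule card_image[OF inj_on_subset[OF f(2)]]) (auto simp: spanning_sets_def)
    ultimately show ?thesis
      using spanning_fraction_ge_trees[OF V(1) equiv_component_rel[of V H]]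
      by (simp add: Z_def C_def)
  qed
  have finK: "finite K" "K \<subseteq> S" using pA(2) by (auto simp: K_def)
  have "card S * C = (\<Sum>H\<in>core ` S. card {F \<in> S. core F = H} * C)"
    using sum.image_gen[OF pA(2), of "\<lambda>_. 1 :: nat" core] by (simp add: sum_distrib_right)
  also have "\<dots> \<le> (\<Sum>H\<in>core ` S. Z * card {F \<in> K. core F = H})"
    using fibre by (rule sum_mono)
  \<comment> \<open>Since \<open>K\<close> is contained in \<open>S\<close>, the cores of its
    members are among the summation indices; fibres without connected graphs contribute
    zero.\<close>
  also have "\<dots> = Z * card K"
    using sum.group[OF finK(1) finite_imageI[OF pA(2)], of core core "\<lambda>_. 1 :: nat"] finK(2)
    by (simp add: sum_distrib_left[symmetric] image_mono)
  finally have "real (card S) * real C \<le> real Z * real (card K)"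
    by (metis of_nat_le_iff of_nat_mult)
  moreover have "card S > 0" "Z > 0"
    using pA(2,3) pF(2,3) by (simp_all add: card_gt_0_iff forests Z_def)
  ultimately have "real C / real Z \<le> real (card K) / real (card S)"
    by (simp add: field_simps)
  then show ?thesis
    using pA(1) pF(1) by (simp add: forests trees Z_def C_def)
qed

theorem mainTheorem2:
  fixes A :: "nat graph set" and n :: nat
  assumes "graph_class A"
    and "bridge_alterable A"
    and "n \<ge> 1"
    and "graphs_on A n \<noteq> {}"
  shows "prob_connected A n
    \<ge> Min {prob_connected forests t | t :: nat. 0.48 * real n \<le> real t \<and> t \<le> n}"
proof -
  let ?P = "{prob_connected forests t | t :: nat. 0.48 * real n \<le> real t \<and> t \<le> n}"
  have "?P \<subseteq> prob_connected forests ` {..n}" by auto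
  then have "finite ?P" by (rule finite_subset) simp
  \<comment> \<open>The witness is \<open>t = n\<close>, admissible since
    \<open>0.48 * real n \<le> real n\<close>.\<close>
  moreover have "prob_connected forests n \<in> ?P" by auto
  ultimately have "Min ?P \<le> prob_connected forests n" by (rule Min_le)
  then show ?thesis using prob_connected_ge_forests[OF assms] by linarith
qed

end
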